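(* Let $(K,\rho)$ be a nonempty compact metric space, let $X=C^0(K\to K)$ with the uniform metric $d_{C^0}$, and let $Y\subset X$ be the set of continuity points of the map $\mathcal{M}:X\to Z$, $T\mapsto\mathcal{M}(K,T)$. Let $T\in Y$ and $\varphi\in C^0(K\to\mathbb{R})$. Then for any $\varepsilon,\sigma>0$ there exists $\delta>0$ such that for any $p\in K$ and any $S\in X$ with $d_{C^0}(S,T)<\delta$ there exist two points $q_-,q_+\in K$ such that, for each of $q=q_-$ and $q=q_+$, $$\liminf_{n\to\infty}\frac{\#\{k=0,\ldots,n-1: S^k(q)\in U_\sigma(\overline{O^+_T(p)})\}}{n}\ge 1-\varepsilon,$$ and the following limits exist and satisfy $$\lim_{n\to\infty}\frac1n\sum_{k=0}^{n-1}\varphi(S^k(q_+))\ge\varphi_p^--\varepsilon,\qquad \lim_{n\to\infty}\frac1n\sum_{k=0}^{n-1}\varphi(S^k(q_-))\le\varphi_p^++\varepsilon,$$ where $$\varphi_p^-=\liminf_{n\to\infty}\frac1n\sum_{k=0}^{n-1}\varphi(T^k(p)),\qquad \varphi_p^+=\limsup_{n\to\infty}\frac1n\sum_{k=0}^{n-1}\varphi(T^k(p)).$$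
   Context: $d_{C^0}(S,T)=\sup_{x\in K}\rho(S(x),T(x))$. $O^+_T(p)=\{T^k(p):k\ge0\}$ is the positive semiorbit of $p$, the bar denotes closure, and $U_\sigma(A)$ is the open $\sigma$-neighbourhood of a compact set $A$. $\mathcal{M}(K)$ is the set of Borel probability measures on $K$ with the Kantorovich–Rubinstein distance $W_1(\mu,\nu)=\sup\left(\int_K f\,d\mu-\int_K f\,d\nu\right)$ (supremum over $1$-Lipschitz $f:K\to\mathbb{R}$), which metrizes the weak-$*$ topology. $\mathcal{M}(K,T)\subset\mathcal{M}(K)$ is the nonempty compact set of $T$-invariant Borel probability measures. $Z$ is the set of nonempty compact subsets of $\mathcal{M}(K)$ with the Hausdorff metric $d_H(P,Q)=\max_{p\in P}W_1(p,Q)+\max_{q\in Q}W_1(q,P)$, where $W_1(p,Q)$ is the distance from the point $p$ to the set $Q$. *)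

theory Defs
  imports "HOL-Probability.Probability"
begin

text \<open>
  The compact metric space \<open>K\<close> is (the universe of) a metric type \<open>'a\<close>, subject to the hypothesis
  \<open>compact (UNIV :: 'a set)\<close>.  For compact \<open>K\<close> every continuous map is bounded, so the library
  type \<open>'a \<Rightarrow>\<^sub>C 'a\<close> is exactly the space \<open>C\<^sup>0(K \<rightarrow> K)\<close>, and its \<open>dist\<close> is the uniform metric.
\<close>

definition borel_probs :: "'a::metric_space measure set" where
  "borel_probs = {\<mu>. sets \<mu> = sets borel \<and> prob_space \<mu>}"

text \<open>
  On a compact space, 1-Lipschitz functions are bounded and integrable, and the supremum is over
  a set of reals bounded by the diameter of the space.
\<close>

definition kr_dist :: "'a::metric_space measure \<Rightarrow> 'a measure \<Rightarrow> real" where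
  "kr_dist \<mu> \<nu> = (SUP f \<in> {f :: 'a \<Rightarrow> real. 1-lipschitz_on UNIV f}.
                     integral\<^sup>L \<mu> f - integral\<^sup>L \<nu> f)"

definition kr_setdist :: "'a::metric_space measure \<Rightarrow> 'a measure set \<Rightarrow> real" where
  "kr_setdist \<mu> Q = (INF \<nu> \<in> Q. kr_dist \<mu> \<nu>)"

text \<open>
  The suprema are maxima when \<open>P\<close> and \<open>Q\<close> are nonempty compact sets of measures.  Note that
  the two one-sided deviations are added.
\<close>

definition hausdorff_kr :: "'a::metric_space measure set \<Rightarrow> 'a measure set \<Rightarrow> real" where
  "hausdorff_kr P Q = (SUP p \<in> P. kr_setdist p Q) + (SUP q \<in> Q. kr_setdist q P)"

definition invariant_probs :: "('a::metric_space \<Rightarrow> 'a) \<Rightarrow> 'a measure set" where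
  "invariant_probs T = {\<mu> \<in> borel_probs. distr \<mu> borel T = \<mu>}"

text \<open>
  Over a compact space the values \<open>invariant_probs T\<close> are always nonempty and compact, so
  continuity at a point, as a map into the hyperspace of nonempty compact sets of measures, is
  a condition on the Hausdorff distances alone.
\<close>

definition continuity_maps :: "('a::metric_space \<Rightarrow>\<^sub>C 'a) set" where
  "continuity_maps = {T. \<forall>e>0. \<exists>d>0. \<forall>S. dist S T < d \<longrightarrow>
      hausdorff_kr (invariant_probs (apply_bcontfun S)) (invariant_probs (apply_bcontfun T)) < e}"

definition pos_semiorbit :: "('a \<Rightarrow> 'a) \<Rightarrow> 'a \<Rightarrow> 'a set" where
  "pos_semiorbit T p = {(T ^^ k) p | k. True}"

definition open_nbhd :: "real \<Rightarrow> 'a::metric_space set \<Rightarrow> 'a set" where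
  "open_nbhd \<sigma> A = (\<Union>a\<in>A. ball a \<sigma>)"

definition visit_freq :: "('a \<Rightarrow> 'a) \<Rightarrow> 'a set \<Rightarrow> 'a \<Rightarrow> nat \<Rightarrow> real" where
  "visit_freq S U q n = real (card {k. k < n \<and> (S ^^ k) q \<in> U}) / real n"

definition birkhoff_avg :: "('a \<Rightarrow> 'a) \<Rightarrow> ('a \<Rightarrow> real) \<Rightarrow> 'a \<Rightarrow> nat \<Rightarrow> real" where
  "birkhoff_avg T \<phi> p n = (1 / real n) * (\<Sum>k<n. \<phi> ((T ^^ k) p))"

text \<open>
  Lower and upper limits are taken in \<open>ereal\<close>; for continuous \<open>\<phi>\<close> on a compact space they are finite.
\<close>

definition lower_avg :: "('a \<Rightarrow> 'a) \<Rightarrow> ('a \<Rightarrow> real) \<Rightarrow> 'a \<Rightarrow> ereal" where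
  "lower_avg T \<phi> p = liminf (\<lambda>n. ereal (birkhoff_avg T \<phi> p n))"

definition upper_avg :: "('a \<Rightarrow> 'a) \<Rightarrow> ('a \<Rightarrow> real) \<Rightarrow> 'a \<Rightarrow> ereal" where
  "upper_avg T \<phi> p = limsup (\<lambda>n. ereal (birkhoff_avg T \<phi> p n))"

end

theory Submission
  imports Defs
begin

text \<open>
  Fix \<open>p\<close> and let \<open>A\<close> be the closure of its orbit under \<open>T\<close>. A weak limit \<open>\<mu>\<close> of the empirical
  measures along the orbit is \<open>T\<close>-invariant and lives on \<open>A\<close>, and \<open>\<integral>\<phi> d\<mu>\<close> lies between the lower and
  the upper orbit average of \<open>\<phi>\<close> (\<open>orbit_limit_measure\<close>). Since \<open>T\<close> is a continuity point, every \<open>S\<close>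
  close to \<open>T\<close> has an invariant measure \<open>\<nu>\<close> close to \<open>\<mu>\<close> in the Kantorovich-Rubinstein distance, with a
  bound on \<open>dist S T\<close> that involves neither \<open>p\<close> nor \<open>\<mu>\<close> (\<open>hausdorff_kr_less_imp_near\<close>). It remains
  to find one \<open>\<nu>\<close>-typical point that satisfies both requirements at once.

  Let \<open>f = max 0 (1 - infdist \<cdot> A / \<sigma>)\<close>. This tent is Lipschitz, equals \<open>1\<close> on \<open>A\<close> and is dominated by the
  indicator of the \<open>\<sigma>\<close>-neighbourhood of \<open>A\<close>, so \<open>\<integral>f d\<mu> = 1\<close> and \<open>\<integral>f d\<nu>\<close> is almost \<open>1\<close>. With a large
  constant \<open>C\<close>, consider the penalised observable \<open>g = \<phi> - C (1 - f)\<close>. Its \<open>\<nu>\<close>-integral is still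
  almost \<open>\<integral>\<phi> d\<mu>\<close>, so the pointwise ergodic theorem yields a point \<open>q\<close> at which the time averages of
  \<open>g\<close> and \<open>f\<close> converge and that of \<open>g\<close> is at least \<open>\<integral>g d\<nu>\<close>. As \<open>g \<le> \<phi>\<close>, the time average of \<open>\<phi>\<close> at
  \<open>q\<close> is large enough; as \<open>\<phi>\<close> is bounded, the penalty leaves no room for \<open>q\<close> to spend more than a
  fraction \<open>\<epsilon>\<close> of its time away from \<open>A\<close> (\<open>exists_typical_point_of_near_measure\<close>). This gives \<open>q\<^sub>+\<close>, and
  \<open>q\<^sub>-\<close> comes from \<open>-\<phi>\<close>.

  Two classical theorems carry this argument and are proved on the way. The pointwise ergodic theorem
  for bounded functions follows from the maximal ergodic theorem applied to \<open>g - limsup + \<eta>\<close>.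
  Sequential compactness of the Borel probability measures on \<open>K\<close> is reduced to Helly's theorem on the
  real line: \<open>K\<close> is coded by real numbers so that the decoding map is continuous on the closure of the
  set of codes.
\<close>

section \<open>Maximal and pointwise ergodic theorem\<close>

lemma birkhoff_avg_le:
  assumes "\<And>x. f x \<le> c" and "0 < n"
  shows "birkhoff_avg T f x n \<le> c"
proof -
  have "(\<Sum>k<n. f ((T ^^ k) x)) \<le> (\<Sum>k<n. c)" by (rule sum_mono) (rule assms)
  then show ?thesis using assms(2) by (simp add: birkhoff_avg_def field_simps)
qed

text \<open>
  The recursion computes the maximum of \<open>0\<close> and the Birkhoff sums of \<open>h\<close> of length at most \<open>n\<close> at \<open>x\<close>.
  In this form the identity \<open>h x = max_birkhoff_sum T h (Suc n) x - max_birkhoff_sum T h n (T x)\<close>, on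
  which the maximal ergodic theorem rests, is immediate wherever the first maximum is positive.
\<close>
primrec max_birkhoff_sum :: "('a \<Rightarrow> 'a) \<Rightarrow> ('a \<Rightarrow> real) \<Rightarrow> nat \<Rightarrow> 'a \<Rightarrow> real" where
  "max_birkhoff_sum T h 0 x = 0"
| "max_birkhoff_sum T h (Suc n) x = max 0 (h x + max_birkhoff_sum T h n (T x))"

lemma max_birkhoff_sum_nonneg: "0 \<le> max_birkhoff_sum T h n x"
  by (cases n) auto

lemma birkhoff_sum_le_max: "(\<Sum>k<n. h ((T ^^ k) x)) \<le> max_birkhoff_sum T h n x"
proof (induction n arbitrary: x)
  case (Suc n)
  have "(\<Sum>k<Suc n. h ((T ^^ k) x)) = h x + (\<Sum>k<n. h ((T ^^ k) (T x)))"
    by (simp add: sum.lessThan_Suc_shift funpow_swap1 del: sum.lessThan_Suc)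
  with Suc[of "T x"] show ?case by auto
qed simp

lemma max_birkhoff_sum_mono_Suc: "max_birkhoff_sum T h n x \<le> max_birkhoff_sum T h (Suc n) x"
proof (induction n arbitrary: x)
  case (Suc n)
  show ?case using Suc[of "T x"] by (auto simp: max_def)
qed simp

lemma max_birkhoff_sum_mono: "m \<le> n \<Longrightarrow> max_birkhoff_sum T h m x \<le> max_birkhoff_sum T h n x"
  by (rule lift_Suc_mono_le[of "\<lambda>n. max_birkhoff_sum T h n x"]) (use max_birkhoff_sum_mono_Suc in auto)

lemma max_birkhoff_sum_le:
  assumes "\<And>x. \<bar>h x\<bar> \<le> B"
  shows "max_birkhoff_sum T h n x \<le> real n * B"
proof (induction n arbitrary: x)
  case (Suc n)
  have "0 \<le> B" using assms[of x] by simp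
  then show ?case using Suc[of "T x"] assms[of x] by (auto simp: algebra_simps)
qed simp

locale measure_preserving_system = prob_space M for M :: "'a measure" +
  fixes T :: "'a \<Rightarrow> 'a"
  assumes T_measurable [measurable]: "T \<in> measurable M M"
    and distr_T: "distr M M T = M"
begin

lemma integral_comp_T:
  fixes f :: "'a \<Rightarrow> real"
  assumes "f \<in> borel_measurable M"
  shows "(\<integral>x. f (T x) \<partial>M) = (\<integral>x. f x \<partial>M)"
  using integral_distr[OF T_measurable assms] distr_T by simp

lemma max_birkhoff_sum_measurable [measurable]:
  assumes [measurable]: "h \<in> borel_measurable M"
  shows "max_birkhoff_sum T h n \<in> borel_measurable M"
proof (induction n)
  case (Suc n)
  note Suc [measurable]
  show ?case by simp
qed simp

text \<open>
  Garsia's argument. Let \<open>m\<^sub>n\<close> be the running maximum. Where \<open>m\<^sub>n\<^sub>+\<^sub>1 > 0\<close>, \<open>h = m\<^sub>n\<^sub>+\<^sub>1 - m\<^sub>n \<circ> T\<close>; elsewhere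
  the right-hand side is at most \<open>0\<close>. Hence the integral of \<open>h\<close> over \<open>{m\<^sub>n\<^sub>+\<^sub>1 > 0}\<close> is at least
  \<open>\<integral>m\<^sub>n\<^sub>+\<^sub>1 - \<integral>m\<^sub>n \<circ> T = \<integral>m\<^sub>n\<^sub>+\<^sub>1 - \<integral>m\<^sub>n \<ge> 0\<close>, and these sets exhaust the space.
\<close>
lemma maximal_ergodic_integral_nonneg:
  fixes h :: "'a \<Rightarrow> real"
  assumes [measurable]: "h \<in> borel_measurable M" and bd: "\<And>x. \<bar>h x\<bar> \<le> B"
    and pos: "\<And>x. \<exists>n. 0 < (\<Sum>k<n. h ((T ^^ k) x))"
  shows "0 \<le> (\<integral>x. h x \<partial>M)"
proof -
  let ?m = "max_birkhoff_sum T h"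
  have B: "0 \<le> B" using bd[of undefined] by simp
  have bint: "integrable M f" if "f \<in> borel_measurable M" "\<And>x. \<bar>f x\<bar> \<le> C" for f :: "'a \<Rightarrow> real" and C
    using that by (intro integrable_const_bound[of _ C]) auto
  have mb: "\<bar>?m n x\<bar> \<le> real n * B" for n x
    using max_birkhoff_sum_nonneg[of T h n x] max_birkhoff_sum_le[of h B T n x] bd by simp
  have mint: "integrable M (?m n)" for n
    by (rule bint[OF _ mb]) simp
  have mTint: "integrable M (\<lambda>x. ?m n (T x))" for n
    by (rule bint[OF _ mb]) simp
  let ?P = "\<lambda>n. {x. 0 < ?m (Suc n) x}"
  have step: "0 \<le> (\<integral>x. h x * indicator (?P n) x \<partial>M)" for n
  proof -
    have "(\<integral>x. ?m n x \<partial>M) \<le> (\<integral>x. ?m (Suc n) x \<partial>M)"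
      by (intro integral_mono mint max_birkhoff_sum_mono_Suc)
    moreover have "(\<integral>x. ?m n (T x) \<partial>M) = (\<integral>x. ?m n x \<partial>M)"
      by (rule integral_comp_T) simp
    ultimately have "0 \<le> (\<integral>x. ?m (Suc n) x - ?m n (T x) \<partial>M)"
      using mint mTint by (simp del: max_birkhoff_sum.simps)
    also have "\<dots> \<le> (\<integral>x. h x * indicator (?P n) x \<partial>M)"
    proof (rule integral_mono)
      show "integrable M (\<lambda>x. ?m (Suc n) x - ?m n (T x))"
        using mint mTint by (simp del: max_birkhoff_sum.simps)
      show "integrable M (\<lambda>x. h x * indicator (?P n) x)"
        by (rule bint[of _ B]) (use bd B in \<open>auto simp: indicator_def\<close>)
      show "?m (Suc n) x - ?m n (T x) \<le> h x * indicator (?P n) x" for x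
        using max_birkhoff_sum_nonneg[of T h n "T x"] by (auto simp: indicator_def)
    qed
    finally show ?thesis .
  qed
  have "(\<lambda>n. \<integral>x. h x * indicator (?P n) x \<partial>M) \<longlonglongrightarrow> (\<integral>x. h x \<partial>M)"
  proof (rule integral_dominated_convergence[where w = "\<lambda>_. B"])
    show "AE x in M. (\<lambda>n. h x * indicator (?P n) x) \<longlonglongrightarrow> h x"
    proof (rule AE_I2, rule tendsto_eventually)
      fix x
      obtain N where "0 < (\<Sum>k<N. h ((T ^^ k) x))" using pos by blast
      then have "0 < ?m N x" using birkhoff_sum_le_max[of h T x N] by simp
      then have "x \<in> ?P n" if "n \<ge> N" for n
        using max_birkhoff_sum_mono[of N "Suc n" T h x] that by simp
      then show "\<forall>\<^sub>F n in sequentially. h x * indicator (?P n) x = h x"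
        by (auto simp: eventually_sequentially indicator_def)
    qed
    show "AE x in M. norm (h x * indicator (?P n) x) \<le> B" for n
      using bd B by (auto simp: indicator_def)
  qed auto
  then show ?thesis
    using step by (intro LIMSEQ_le_const) auto
qed

text \<open>
  The upper time average \<open>u\<close> is \<open>T\<close>-invariant, so the Birkhoff sums of \<open>g - u + \<eta>\<close> become positive at
  every point for each \<open>\<eta> > 0\<close>, and the maximal ergodic theorem applies.
\<close>
lemma integral_limsup_birkhoff_avg_le:
  assumes g [measurable]: "g \<in> borel_measurable M" and bd: "\<And>x. \<bar>g x\<bar> \<le> B"
  defines "u \<equiv> \<lambda>x. real_of_ereal (limsup (\<lambda>n. ereal (birkhoff_avg T g x n)))"
  shows "u \<in> borel_measurable M" and "\<bar>u x\<bar> \<le> B"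
    and "limsup (\<lambda>n. ereal (birkhoff_avg T g x n)) = ereal (u x)"
    and "(\<integral>x. u x \<partial>M) \<le> (\<integral>x. g x \<partial>M)"
proof -
  have B: "0 \<le> B" using bd[of undefined] by simp
  have avgb: "\<bar>birkhoff_avg T g x n\<bar> \<le> B" for x n
  proof (cases "n = 0")
    case False
    have "\<bar>\<Sum>k<n. g ((T ^^ k) x)\<bar> \<le> (\<Sum>k<n. B)"
      by (rule order_trans[OF sum_abs sum_mono[OF bd]])
    then show ?thesis using False by (simp add: birkhoff_avg_def field_simps)
  qed (use B in \<open>simp add: birkhoff_avg_def\<close>)
  have lsb: "ereal (-B) \<le> limsup (\<lambda>n. ereal (birkhoff_avg T g x n))"
            "limsup (\<lambda>n. ereal (birkhoff_avg T g x n)) \<le> ereal B" for x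
  proof -
    show "limsup (\<lambda>n. ereal (birkhoff_avg T g x n)) \<le> ereal B"
      by (rule Limsup_bounded) (use avgb[of x] in \<open>auto simp: abs_le_iff\<close>)
    have "ereal (-B) \<le> liminf (\<lambda>n. ereal (birkhoff_avg T g x n))"
      by (rule Liminf_bounded) (use avgb[of x] in \<open>auto simp: abs_le_iff minus_le_iff\<close>)
    also have "\<dots> \<le> limsup (\<lambda>n. ereal (birkhoff_avg T g x n))"
      by (rule Liminf_le_Limsup) simp
    finally show "ereal (-B) \<le> \<dots>" .
  qed
  show lim: "limsup (\<lambda>n. ereal (birkhoff_avg T g x n)) = ereal (u x)" for x
    unfolding u_def using lsb[of x] by (cases "limsup (\<lambda>n. ereal (birkhoff_avg T g x n))") auto
  show ub: "\<bar>u x\<bar> \<le> B" for x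
    using lsb[of x] unfolding lim by auto
  have Tn [measurable]: "(T ^^ n) \<in> measurable M M" for n
    by (induction n) (auto simp: id_def comp_def intro: measurable_compose[OF _ T_measurable])
  have am [measurable]: "(\<lambda>x. birkhoff_avg T g x n) \<in> borel_measurable M" for n
    unfolding birkhoff_avg_def by measurable
  show um [measurable]: "u \<in> borel_measurable M"
    unfolding u_def by measurable
  have uT: "u (T x) = u x" for x
  proof -
    have *: "birkhoff_avg T g (T x) n = (g ((T ^^ n) x) - g x) / real n + birkhoff_avg T g x n" for n
    proof -
      have "(\<Sum>k<n. g ((T ^^ k) (T x))) = (\<Sum>k<Suc n. g ((T ^^ k) x)) - g x"
        by (simp add: sum.lessThan_Suc_shift funpow_swap1 del: sum.lessThan_Suc)
      then show ?thesis by (simp add: birkhoff_avg_def add_divide_distrib diff_divide_distrib)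
    qed
    have "(\<lambda>n. (g ((T ^^ n) x) - g x) / real n) \<longlonglongrightarrow> 0"
    proof (rule Lim_null_comparison[where g = "\<lambda>n. 2 * B / real n"])
      have "\<bar>g ((T ^^ n) x) - g x\<bar> \<le> 2 * B" for n
        using bd[of "(T ^^ n) x"] bd[of x] by linarith
      then show "\<forall>\<^sub>F n in sequentially. norm ((g ((T ^^ n) x) - g x) / real n) \<le> 2 * B / real n"
        by (auto intro!: always_eventually divide_right_mono)
      show "(\<lambda>n. 2 * B / real n) \<longlonglongrightarrow> 0" by (rule lim_const_over_n)
    qed
    then have "(\<lambda>n. ereal ((g ((T ^^ n) x) - g x) / real n)) \<longlonglongrightarrow> 0"
      by (simp add: zero_ereal_def)
    from ereal_limsup_lim_add[OF this, of "\<lambda>n. ereal (birkhoff_avg T g x n)"]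
    have "limsup (\<lambda>n. ereal (birkhoff_avg T g (T x) n)) = limsup (\<lambda>n. ereal (birkhoff_avg T g x n))"
      by (simp add: *)
    then show ?thesis by (simp add: u_def)
  qed
  have ukT: "u ((T ^^ k) x) = u x" for k x
    by (induction k) (auto simp: uT)
  have int: "integrable M g" "integrable M u"
    using bd ub by (auto intro!: integrable_const_bound[of _ B])
  have "(\<integral>x. u x \<partial>M) \<le> (\<integral>x. g x \<partial>M) + \<eta>" if \<eta>: "0 < \<eta>" for \<eta>
  proof -
    have "0 \<le> (\<integral>x. g x - u x + \<eta> \<partial>M)"
    proof (rule maximal_ergodic_integral_nonneg)
      show "\<bar>g x - u x + \<eta>\<bar> \<le> 2 * B + \<eta>" for x
        using bd[of x] ub[of x] \<eta> by linarith
      show "\<exists>n. 0 < (\<Sum>k<n. g ((T ^^ k) x) - u ((T ^^ k) x) + \<eta>)" for x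
      proof -
        have "\<exists>n>0. u x - \<eta> < birkhoff_avg T g x n"
        proof (rule ccontr)
          assume "\<not> ?thesis"
          then have "\<forall>n\<ge>1. birkhoff_avg T g x n \<le> u x - \<eta>"
            by (meson not_less less_le_trans zero_less_one)
          then have "\<forall>\<^sub>F n in sequentially. ereal (birkhoff_avg T g x n) \<le> ereal (u x - \<eta>)"
            unfolding eventually_sequentially by auto
          then have "limsup (\<lambda>n. ereal (birkhoff_avg T g x n)) \<le> ereal (u x - \<eta>)"
            by (rule Limsup_bounded)
          then show False using \<eta> by (simp add: lim)
        qed
        then obtain n where "0 < n" "u x - \<eta> < birkhoff_avg T g x n" by auto
        then have "0 < (\<Sum>k<n. g ((T ^^ k) x)) - n * u x + n * \<eta>"
          by (simp add: birkhoff_avg_def field_simps)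
        then show ?thesis
          by (auto simp: ukT sum.distrib sum_subtractf intro!: exI[of _ n])
      qed
    qed simp
    then show ?thesis using int by (simp add: prob_space)
  qed
  then show "(\<integral>x. u x \<partial>M) \<le> (\<integral>x. g x \<partial>M)" by (rule field_le_epsilon)
qed

text \<open>
  The previous bound for \<open>g\<close> and for \<open>-g\<close> gives \<open>\<integral>limsup \<le> \<integral>g \<le> \<integral>liminf\<close>, while \<open>liminf \<le> limsup\<close> pointwise;
  so the two agree almost everywhere and have the integral of \<open>g\<close>.
\<close>
lemma pointwise_ergodic_theorem_bounded:
  assumes g [measurable]: "g \<in> borel_measurable M" and bd: "\<And>x. \<bar>g x\<bar> \<le> B"
  obtains u where "u \<in> borel_measurable M" "\<And>x. \<bar>u x\<bar> \<le> B"
    "AE x in M. birkhoff_avg T g x \<longlonglongrightarrow> u x" "(\<integral>x. u x \<partial>M) = (\<integral>x. g x \<partial>M)"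
proof -
  define u where "u x = real_of_ereal (limsup (\<lambda>n. ereal (birkhoff_avg T g x n)))" for x
  define v where "v x = real_of_ereal (limsup (\<lambda>n. ereal (birkhoff_avg T (\<lambda>x. - g x) x n)))" for x
  have m: "(\<lambda>x. - g x) \<in> borel_measurable M" by simp
  have b: "\<bar>- g x\<bar> \<le> B" for x using bd by simp
  note U = integral_limsup_birkhoff_avg_le[OF g bd, folded u_def]
  note V = integral_limsup_birkhoff_avg_le[OF m b, folded v_def]
  have neg: "birkhoff_avg T (\<lambda>x. - g x) x n = - birkhoff_avg T g x n" for x n
    by (simp add: birkhoff_avg_def sum_negf)
  have lo: "liminf (\<lambda>n. ereal (birkhoff_avg T g x n)) = ereal (- v x)" for x
  proof -
    have "- liminf (\<lambda>n. ereal (birkhoff_avg T g x n)) = limsup (\<lambda>n. - ereal (birkhoff_avg T g x n))"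
      by (rule ereal_Limsup_uminus[symmetric])
    also have "\<dots> = ereal (v x)" using V(3)[of x] by (simp add: neg)
    finally show ?thesis by (metis ereal_uminus_uminus uminus_ereal.simps(1))
  qed
  have int: "integrable M g" "integrable M u" "integrable M v"
    using bd U(1,2) V(1,2) by (auto intro!: integrable_const_bound[of _ B])
  have le: "0 \<le> u x + v x" for x
    using Liminf_le_Limsup[of sequentially "\<lambda>n. ereal (birkhoff_avg T g x n)"] by (simp add: lo U(3))
  have "(\<integral>x. u x + v x \<partial>M) \<le> 0"
    using U(4) V(4) int by simp
  moreover have "0 \<le> (\<integral>x. u x + v x \<partial>M)" using le by simp
  ultimately have zero: "(\<integral>x. u x + v x \<partial>M) = 0" by simp
  then have "AE x in M. u x + v x = 0"
    using int le by (subst (asm) integral_nonneg_eq_0_iff_AE) auto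
  then have "AE x in M. birkhoff_avg T g x \<longlonglongrightarrow> u x"
  proof eventually_elim
    case (elim x)
    then have "(\<lambda>n. ereal (birkhoff_avg T g x n)) \<longlonglongrightarrow> ereal (u x)"
      by (subst tendsto_iff_Liminf_eq_Limsup) (auto simp: lo U(3))
    then show ?case by simp
  qed
  moreover have "(\<integral>x. u x \<partial>M) = (\<integral>x. g x \<partial>M)"
    using U(4) V(4) zero int by simp
  ultimately show thesis using that U(1,2) by blast
qed

text \<open>
  A function cannot lie strictly below its own integral almost everywhere.
\<close>
lemma exists_point_birkhoff_limit_ge:
  assumes g: "g \<in> borel_measurable M" and bd: "\<And>x. \<bar>g x\<bar> \<le> B" and ae: "AE x in M. P x"
  obtains x l where "x \<in> space M" "P x" "birkhoff_avg T g x \<longlonglongrightarrow> l" "(\<integral>x. g x \<partial>M) \<le> l"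
proof -
  obtain u where u: "u \<in> borel_measurable M" "\<And>x. \<bar>u x\<bar> \<le> B"
    "AE x in M. birkhoff_avg T g x \<longlonglongrightarrow> u x" "(\<integral>x. u x \<partial>M) = (\<integral>x. g x \<partial>M)"
    using pointwise_ergodic_theorem_bounded[OF g bd] by blast
  have "\<exists>x\<in>space M. P x \<and> birkhoff_avg T g x \<longlonglongrightarrow> u x \<and> (\<integral>x. g x \<partial>M) \<le> u x"
  proof (rule ccontr)
    assume none: "\<not> ?thesis"
    have "AE x in M. u x < (\<integral>x. g x \<partial>M)"
      using ae u(3) AE_space by eventually_elim (use none in \<open>auto simp: not_le\<close>)
    moreover have "integrable M u" using u by (auto intro!: integrable_const_bound[of _ B])
    ultimately have "(\<integral>x. u x \<partial>M) < (\<integral>x. (\<integral>x. g x \<partial>M) \<partial>M)"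
      by (intro integral_less_AE_space) (auto simp: emeasure_space_1)
    then show False using u(4) by (simp add: prob_space)
  qed
  then show thesis using that by blast
qed

end

section \<open>Coding a compact metric space by real numbers\<close>

text \<open>
  A point is coded by the real number whose ternary digits, all \<open>0\<close> or \<open>1\<close>, record to which of the sets
  \<open>B n\<close> it belongs. Base three leaves gaps, so that nearby codes share their leading digits.
\<close>
definition digit_code :: "(nat \<Rightarrow> 'a set) \<Rightarrow> 'a \<Rightarrow> real" where
  "digit_code B x = (\<Sum>n. indicator (B n) x * (1/3) ^ n)"

lemma summable_digit_code: "summable (\<lambda>n. indicator (B n) x * (1/3 :: real) ^ n)"
  by (rule summable_comparison_test'[of "\<lambda>n. (1/3) ^ n" 0]) (auto simp: indicator_def)

lemma digit_code_range: "digit_code B x \<in> {0..3/2}"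
proof -
  have "digit_code B x \<le> (\<Sum>n. (1/3) ^ n)"
    unfolding digit_code_def
    by (rule suminf_le[OF _ summable_digit_code]) (auto simp: indicator_def)
  moreover have "0 \<le> digit_code B x"
    unfolding digit_code_def by (rule suminf_nonneg[OF summable_digit_code]) auto
  ultimately show ?thesis by (simp add: suminf_geometric)
qed

text \<open>
  If the first difference is at digit \<open>m\<close>, it contributes \<open>3\<^sup>-\<^sup>m\<close>, whereas all later digits together
  contribute at most half of that.
\<close>
lemma digit_code_close:
  assumes close: "\<bar>digit_code B x - digit_code B y\<bar> < (1/3) ^ N / 2" and "n < N"
  shows "x \<in> B n \<longleftrightarrow> y \<in> B n"
proof (rule ccontr)
  assume differ: "\<not> ?thesis"
  define d :: "nat \<Rightarrow> real" where "d k = indicator (B k) x - indicator (B k) y" for k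
  define m where "m = (LEAST k. d k \<noteq> 0)"
  have "d n \<noteq> 0" using differ by (auto simp: d_def indicator_def)
  then have dm: "d m \<noteq> 0" and mn: "m \<le> n"
    unfolding m_def using LeastI[of "\<lambda>k. d k \<noteq> 0" n] Least_le[of "\<lambda>k. d k \<noteq> 0" n] by auto
  have d0: "d k = 0" if "k < m" for k
    using that not_less_Least unfolding m_def by blast
  have dle: "\<bar>d k\<bar> \<le> 1" for k by (auto simp: d_def indicator_def)
  have dm1: "\<bar>d m\<bar> = 1" using dm by (auto simp: d_def indicator_def split: if_splits)
  have sd: "summable (\<lambda>k. d k * (1/3) ^ k)"
    using summable_diff[OF summable_digit_code[of B x] summable_digit_code[of B y]]
    by (simp add: d_def algebra_simps)
  have "digit_code B x - digit_code B y = (\<Sum>k. d k * (1/3) ^ k)"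
    unfolding digit_code_def d_def
    by (subst suminf_diff[OF summable_digit_code summable_digit_code]) (simp add: algebra_simps)
  also have "\<dots> = (\<Sum>k. d (k + Suc m) * (1/3) ^ (k + Suc m)) + (\<Sum>k<Suc m. d k * (1/3) ^ k)"
    by (rule suminf_split_initial_segment[OF sd])
  also have "(\<Sum>k<Suc m. d k * (1/3) ^ k) = d m * (1/3) ^ m"
    by (simp add: d0)
  finally have eq: "digit_code B x - digit_code B y
      = (\<Sum>k. d (k + Suc m) * (1/3) ^ (k + Suc m)) + d m * (1/3) ^ m" .
  have geo: "(\<lambda>k. (1/3) ^ (k + Suc m)) sums ((1/3) ^ m / 2 :: real)"
    using sums_mult[OF geometric_sums[of "1/3 :: real"], of "(1/3) ^ Suc m"]
    by (simp add: power_add mult.commute)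
  have "\<bar>\<Sum>k. d (k + Suc m) * (1/3) ^ (k + Suc m)\<bar> \<le> (\<Sum>k. (1/3) ^ (k + Suc m))"
  proof -
    have nb: "norm (d (k + Suc m) * (1/3) ^ (k + Suc m)) \<le> (1/3) ^ (k + Suc m)" for k
      using dle[of "k + Suc m"] by (simp add: abs_mult mult_left_le_one_le)
    show ?thesis
      using norm_suminf_le[OF nb sums_summable[OF geo]] by simp
  qed
  also have "\<dots> = (1/3) ^ m / 2" using geo by (simp add: sums_iff)
  finally have "(1/3) ^ m / 2 \<le> \<bar>digit_code B x - digit_code B y\<bar>"
    using dm1 unfolding eq by (auto simp: abs_if split: if_splits)
  moreover have "(1/3 :: real) ^ N \<le> (1/3) ^ m"
    using mn \<open>n < N\<close> by (intro power_decreasing) auto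
  ultimately show False using close by simp
qed

text \<open>
  The balls of radius \<open>1/(m+1)\<close> around finite nets, enumerated over all \<open>m\<close>. Finiteness of the nets is
  what makes the index bound \<open>N\<close> uniform in \<open>x\<close>, hence the decoding uniformly continuous.
\<close>
lemma compact_fine_base:
  assumes "compact (UNIV :: 'a::metric_space set)"
  obtains B :: "nat \<Rightarrow> 'a::metric_space set" where "\<And>n. open (B n)"
    and "\<And>e. 0 < e \<Longrightarrow> \<exists>N. \<forall>x. \<exists>n<N. x \<in> B n \<and> (\<forall>y\<in>B n. dist x y < e)"
proof -
  have "\<forall>e>0. \<exists>F :: 'a set. finite F \<and> (\<Union>x\<in>F. ball x e) = UNIV"
    using compact_imp_seq_compact[OF assms] seq_compact_imp_totally_bounded
    by (metis top.extremum_uniqueI)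
  then obtain F :: "real \<Rightarrow> 'a set" where F: "\<And>e. 0 < e \<Longrightarrow> finite (F e)"
      "\<And>e. 0 < e \<Longrightarrow> (\<Union>x\<in>F e. ball x e) = UNIV"
    by metis
  define \<B> where "\<B> = (\<Union>m. (\<lambda>x. ball x (1 / Suc m)) ` F (1 / Suc m))"
  have "countable \<B>"
    unfolding \<B>_def
    by (intro countable_UN[OF countableI_type] countable_image countable_finite F(1)) auto
  moreover have "F 1 \<noteq> {}" using F(2)[of 1] by auto
  then have "\<B> \<noteq> {}" unfolding \<B>_def by (auto intro!: exI[of _ 0])
  ultimately have range: "range (from_nat_into \<B>) = \<B>"
    by (rule range_from_nat_into[rotated])
  show thesis
  proof (rule that[of "from_nat_into \<B>"])
    show "open (from_nat_into \<B> n)" for n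
    proof -
      have "from_nat_into \<B> n \<in> \<B>" using range by blast
      then show ?thesis by (auto simp: \<B>_def)
    qed
    show "\<exists>N. \<forall>x. \<exists>n<N. x \<in> from_nat_into \<B> n \<and> (\<forall>y\<in>from_nat_into \<B> n. dist x y < e)"
      if e: "0 < e" for e
    proof -
      obtain m where m: "1 / real (Suc m) < e / 2"
        using nat_approx_posE[OF half_gt_zero[OF e]] by blast
      let ?r = "1 / real (Suc m)"
      have r: "0 < ?r" by simp
      have "\<forall>x\<in>F ?r. \<exists>n. from_nat_into \<B> n = ball x ?r"
      proof
        fix x assume "x \<in> F ?r"
        then have "ball x ?r \<in> range (from_nat_into \<B>)" unfolding range by (auto simp: \<B>_def)
        then show "\<exists>n. from_nat_into \<B> n = ball x ?r" by (metis rangeE)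
      qed
      then obtain k where k: "\<And>x. x \<in> F ?r \<Longrightarrow> from_nat_into \<B> (k x) = ball x ?r"
        by metis
      obtain N where N: "\<And>x. x \<in> F ?r \<Longrightarrow> k x < N"
        using finite_nat_set_iff_bounded[of "k ` F ?r"] F(1)[OF r] by auto
      show ?thesis
      proof (rule exI[of _ N], rule allI)
        fix x
        obtain c where c: "c \<in> F ?r" "x \<in> ball c ?r" using F(2)[OF r] by blast
        have "dist x y < e" if "y \<in> ball c ?r" for y
          using c(2) that m dist_triangle_less_add[of x c "e/2" y "e/2"] by (auto simp: dist_commute)
        then show "\<exists>n<N. x \<in> from_nat_into \<B> n \<and> (\<forall>y\<in>from_nat_into \<B> n. dist x y < e)"
          using c k N by (intro exI[of _ "k c"]) auto
      qed
    qed
  qed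
qed

text \<open>
  Nearby codes share many leading digits, and points that lie in the same small ball are close; so
  decoding is uniformly continuous on the codes and extends to their closure. The extension is built
  from limits of preimages, which exist by compactness: \<open>lim c y\<close> says that \<open>y\<close> is a limit of points
  whose codes tend to \<open>c\<close>.
\<close>
lemma compact_metric_real_code:
  assumes comp: "compact (UNIV :: 'a::metric_space set)"
  obtains e :: "'a::metric_space \<Rightarrow> real" and \<pi> :: "real \<Rightarrow> 'a"
  where "e \<in> borel_measurable borel" "\<And>x. e x \<in> {0..3/2}" "\<And>x. \<pi> (e x) = x"
    "continuous_on (closure (range e)) \<pi>"
proof -
  obtain B :: "nat \<Rightarrow> 'a set" where B: "\<And>n. open (B n)"
    "\<And>e. 0 < e \<Longrightarrow> \<exists>N. \<forall>x. \<exists>n<N. x \<in> B n \<and> (\<forall>y\<in>B n. dist x y < e)"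
    using compact_fine_base[OF comp] by blast
  define e where "e = digit_code B"
  have modulus: "\<exists>d>0. \<forall>x y. \<bar>e x - e y\<bar> < d \<longrightarrow> dist x y < r" if r: "0 < r" for r
  proof -
    obtain N where N: "\<forall>x. \<exists>n<N. x \<in> B n \<and> (\<forall>y\<in>B n. dist x y < r)" using B(2)[OF r] ..
    show ?thesis
    proof (intro exI[of _ "(1/3)^N / 2"] conjI allI impI)
      fix x y assume close: "\<bar>e x - e y\<bar> < (1/3)^N / 2"
      obtain n where n: "n < N" "x \<in> B n" "\<forall>y\<in>B n. dist x y < r" using N by blast
      have "y \<in> B n"
        using digit_code_close[OF close[unfolded e_def] n(1)] n(2) by simp
      then show "dist x y < r" using n(3) by blast
    qed simp
  qed
  define lim where "lim c y \<longleftrightarrow> (\<exists>x. (\<lambda>n. e (x n)) \<longlonglongrightarrow> c \<and> x \<longlonglongrightarrow> y)" for c y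
  have lim_ex: "\<exists>y. lim c y" if c: "c \<in> closure (range e)" for c
  proof -
    obtain s where s: "\<And>n. s n \<in> range e" "s \<longlonglongrightarrow> c"
      using c[unfolded closure_sequential] by blast
    then have "\<forall>n. \<exists>z. s n = e z" by blast
    then obtain x where x: "\<And>n. s n = e (x n)" by metis
    obtain y r where r: "strict_mono r" "(x \<circ> r) \<longlonglongrightarrow> y"
      using comp unfolding compact_eq_seq_compact_metric seq_compact_def by blast
    have "s = (\<lambda>n. e (x n))" using x by auto
    then have "(\<lambda>n. e ((x \<circ> r) n)) \<longlonglongrightarrow> c"
      using LIMSEQ_subseq_LIMSEQ[OF s(2) r(1)] by (simp add: comp_def)
    with r show ?thesis unfolding lim_def by blast
  qed
  have lim_close: "\<exists>d>0. \<forall>c y c' y'. lim c y \<longrightarrow> lim c' y' \<longrightarrow> dist c c' < d \<longrightarrow> dist y y' < r"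
    if r: "0 < r" for r
  proof -
    obtain d where d: "0 < d" "\<And>x y. \<bar>e x - e y\<bar> < d \<Longrightarrow> dist x y < r / 2"
      using modulus[of "r / 2"] r by auto
    have "dist y y' < r" if "lim c y" "lim c' y'" "dist c c' < d" for c y c' y'
    proof -
      obtain x x' where x: "(\<lambda>n. e (x n)) \<longlonglongrightarrow> c" "x \<longlonglongrightarrow> y"
        "(\<lambda>n. e (x' n)) \<longlonglongrightarrow> c'" "x' \<longlonglongrightarrow> y'"
        using \<open>lim c y\<close> \<open>lim c' y'\<close> unfolding lim_def by blast
      have "(\<lambda>n. dist (e (x n)) (e (x' n))) \<longlonglongrightarrow> dist c c'"
        using x by (intro tendsto_intros)
      then have "\<forall>\<^sub>F n in sequentially. dist (e (x n)) (e (x' n)) < d"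
        using that(3) by (rule order_tendstoD)
      then have "\<forall>\<^sub>F n in sequentially. dist (x n) (x' n) \<le> r / 2"
        by eventually_elim (use d(2) in \<open>auto simp: dist_real_def intro: less_imp_le\<close>)
      moreover have "(\<lambda>n. dist (x n) (x' n)) \<longlonglongrightarrow> dist y y'"
        using x by (intro tendsto_intros)
      ultimately have "dist y y' \<le> r / 2"
        by (intro tendsto_upperbound[where F = sequentially]) auto
      with r show ?thesis by simp
    qed
    with d(1) show ?thesis by blast
  qed
  define \<pi> where "\<pi> c = (SOME y. lim c y)" for c
  have \<pi>: "lim c (\<pi> c)" if "c \<in> closure (range e)" for c
    unfolding \<pi>_def using lim_ex[OF that] by (rule someI_ex)
  show thesis
  proof (rule that[of e \<pi>])
    show "e \<in> borel_measurable borel"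
      unfolding e_def digit_code_def
      using B(1) by (intro borel_measurable_suminf borel_measurable_times borel_measurable_indicator) auto
    show "e x \<in> {0..3/2}" for x
      unfolding e_def by (rule digit_code_range)
    show "continuous_on (closure (range e)) \<pi>"
      unfolding continuous_on_iff using lim_close \<pi> by (metis dist_commute)
    show "\<pi> (e x) = x" for x
    proof -
      have "lim (e x) x" unfolding lim_def by (intro exI[of _ "\<lambda>_. x"]) simp
      moreover have "lim (e x) (\<pi> (e x))"
        by (rule \<pi>) (auto intro: closure_subset[THEN subsetD])
      ultimately have "dist (\<pi> (e x)) x < r" if "0 < r" for r
        using lim_close[OF that] by (metis dist_self)
      then show ?thesis by (metis dist_eq_0_iff dist_not_less_zero less_irrefl linorder_neqE_linordered_idom)
    qed
  qed
qed

section \<open>Weak compactness and invariant measures\<close>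

lemma continuous_compact_bounded:
  fixes f :: "'a::metric_space \<Rightarrow> real"
  assumes "compact (UNIV :: 'a set)" "continuous_on UNIV f"
  obtains B where "0 < B" "\<And>x. \<bar>f x\<bar> \<le> B"
proof -
  have "bounded (range f)"
    using assms by (intro compact_imp_bounded compact_continuous_image) auto
  then show thesis using that unfolding bounded_pos by auto
qed

lemma borel_probs_integrable:
  fixes f :: "'a::metric_space \<Rightarrow> real"
  assumes "compact (UNIV :: 'a set)" "continuous_on UNIV f" "\<mu> \<in> borel_probs"
  shows "integrable \<mu> f"
proof -
  interpret prob_space \<mu> using assms(3) by (simp add: borel_probs_def)
  have s: "sets \<mu> = sets borel" using assms(3) by (simp add: borel_probs_def)
  obtain B where "\<And>x. \<bar>f x\<bar> \<le> B" using continuous_compact_bounded[OF assms(1,2)] by blast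
  moreover have "f \<in> borel_measurable \<mu>"
    using borel_measurable_continuous_onI[OF assms(2)] s measurable_cong_sets by blast
  ultimately show ?thesis by (intro integrable_const_bound[of _ B]) auto
qed

text \<open>
  The indicator of a closed set \<open>A\<close> is the limit of the continuous functions \<open>max 0 (1 - n infdist \<cdot> A)\<close>, and
  the closed sets form an intersection-stable generator of the Borel sets.
\<close>
lemma borel_probs_eqI:
  fixes \<mu> \<nu> :: "'a::metric_space measure"
  assumes \<mu>: "\<mu> \<in> borel_probs" and \<nu>: "\<nu> \<in> borel_probs"
    and eq: "\<And>f :: 'a \<Rightarrow> real. continuous_on UNIV f \<Longrightarrow> (\<And>x. f x \<in> {0..1}) \<Longrightarrow>
               (\<integral>x. f x \<partial>\<mu>) = (\<integral>x. f x \<partial>\<nu>)"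
  shows "\<mu> = \<nu>"
proof (rule measure_eqI_generator_eq[where E = "Collect closed" and \<Omega> = UNIV and A = "\<lambda>_. UNIV"])
  have lim: "(\<lambda>n. \<integral>x. max 0 (1 - real n * infdist x A) \<partial>\<rho>) \<longlonglongrightarrow> measure \<rho> A"
    if \<rho>: "\<rho> \<in> borel_probs" and A: "closed A" "A \<noteq> {}" for \<rho> and A :: "'a set"
  proof -
    interpret prob_space \<rho> using \<rho> by (simp add: borel_probs_def)
    have s [measurable_cong]: "sets \<rho> = sets borel" using \<rho> by (simp add: borel_probs_def)
    have [measurable]: "A \<in> sets borel" using A by simp
    have [measurable]: "(\<lambda>x. infdist x A) \<in> borel_measurable borel"
      by (intro borel_measurable_continuous_onI continuous_intros)
    have "(\<lambda>n. \<integral>x. max 0 (1 - real n * infdist x A) \<partial>\<rho>) \<longlonglongrightarrow> (\<integral>x. indicator A x \<partial>\<rho>)"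
    proof (rule integral_dominated_convergence[where w = "\<lambda>_. 1"])
      show "AE x in \<rho>. (\<lambda>n. max 0 (1 - real n * infdist x A)) \<longlonglongrightarrow> indicator A x"
      proof (rule AE_I2)
        fix x
        show "(\<lambda>n. max 0 (1 - real n * infdist x A)) \<longlonglongrightarrow> indicator A x"
        proof (cases "x \<in> A")
          case False
          then have d: "0 < infdist x A"
            using in_closed_iff_infdist_zero[OF A] infdist_nonneg[of x A] by (metis le_neq_trans)
          obtain N where N: "1 < real N * infdist x A" using reals_Archimedean3[OF d] by blast
          have "max 0 (1 - real n * infdist x A) = 0" if "N \<le> n" for n
          proof -
            have "real N * infdist x A \<le> real n * infdist x A"
              using that d by (intro mult_right_mono) auto
            then show ?thesis using N by simp
          qed
          then have "\<forall>\<^sub>F n in sequentially. max 0 (1 - real n * infdist x A) = indicator A x"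
            using False by (auto simp: eventually_sequentially)
          then show ?thesis by (rule tendsto_eventually)
        qed simp
      qed
      show "AE x in \<rho>. norm (max 0 (1 - real n * infdist x A)) \<le> 1" for n
        by (rule AE_I2) (auto intro!: mult_nonneg_nonneg infdist_nonneg)
    qed auto
    then show ?thesis by (simp add: s[THEN sets_eq_imp_space_eq])
  qed
  show "emeasure \<mu> X = emeasure \<nu> X" if "X \<in> Collect closed" for X
  proof (cases "X = {}")
    case False
    have "(\<integral>x. max 0 (1 - real n * infdist x X) \<partial>\<mu>) = (\<integral>x. max 0 (1 - real n * infdist x X) \<partial>\<nu>)" for n
      by (rule eq) (auto intro!: continuous_intros mult_nonneg_nonneg infdist_nonneg)
    then have "measure \<mu> X = measure \<nu> X"
      using lim[OF \<mu>, of X] lim[OF \<nu>, of X] False that LIMSEQ_unique by simp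
    then show ?thesis
      using \<mu> \<nu> by (simp add: borel_probs_def prob_space_def finite_measure.emeasure_eq_measure)
  qed simp
  show "sets \<mu> = sigma_sets UNIV (Collect closed)" "sets \<nu> = sigma_sets UNIV (Collect closed)"
    using \<mu> \<nu> by (simp_all add: borel_probs_def borel_eq_closed)
  show "emeasure \<mu> UNIV \<noteq> \<infinity>"
    using \<mu> by (simp add: borel_probs_def prob_space_def finite_measure.emeasure_finite)
qed (auto simp: Int_stable_def)

text \<open>
  Push the measures forward to the real line by the coding \<open>e\<close>, extract a weakly convergent subsequence by
  Helly's theorem, and pull its limit back by the decoding \<open>\<pi>\<close>. The limit is concentrated on the closed
  set \<open>C\<close> where \<open>\<pi>\<close> is continuous, and \<open>f \<circ> \<pi>\<close> extends from \<open>C\<close> to a bounded continuous function on the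
  line by Tietze's theorem, so that weak convergence on the line transfers to \<open>K\<close>.
\<close>
lemma borel_probs_sequentially_compact:
  fixes \<mu> :: "nat \<Rightarrow> 'a::metric_space measure"
  assumes comp: "compact (UNIV :: 'a set)" and \<mu>: "\<And>n. \<mu> n \<in> borel_probs"
  obtains r \<nu> where "strict_mono (r :: nat \<Rightarrow> nat)" "\<nu> \<in> borel_probs"
    "\<And>f :: 'a \<Rightarrow> real. continuous_on UNIV f \<Longrightarrow>
       (\<lambda>n. \<integral>x. f x \<partial>\<mu> (r n)) \<longlonglongrightarrow> (\<integral>x. f x \<partial>\<nu>)"
proof -
  obtain e :: "'a \<Rightarrow> real" and \<pi> :: "real \<Rightarrow> 'a"
    where e [measurable]: "e \<in> borel_measurable borel" and rng: "\<And>x. e x \<in> {0..3/2}"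
      and inv: "\<And>x. \<pi> (e x) = x" and cont: "continuous_on (closure (range e)) \<pi>"
    using compact_metric_real_code[OF comp] by blast
  define C where "C = closure (range e)"
  have C: "closed C" "C \<noteq> {}" "\<And>x. e x \<in> C"
    unfolding C_def by (auto intro: closure_subset[THEN subsetD])
  have rng_half_open: "e x \<in> {-1<..2}" for x
    using rng[of x] by auto
  have P: "prob_space (\<mu> n)" and s [measurable_cong]: "sets (\<mu> n) = sets borel" for n
    using \<mu>[of n] by (auto simp: borel_probs_def)
  define L where "L n = distr (\<mu> n) borel e" for n
  have L: "real_distribution (L n)" for n
    unfolding L_def by (intro prob_space.real_distribution_distr P) simp
  have intL: "(\<integral>t. g t \<partial>L n) = (\<integral>x. g (e x) \<partial>\<mu> n)"
    if "g \<in> borel_measurable borel" for g :: "real \<Rightarrow> real" and n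
    unfolding L_def using that by (subst integral_distr) auto
  have "tight L"
    unfolding tight_def
  proof (intro conjI allI impI L)
    fix \<epsilon> :: real assume "0 < \<epsilon>"
    have "measure (L n) {-1<..2} = 1" for n
    proof -
      have "e -` {-1<..2} \<inter> space (\<mu> n) = space (\<mu> n)"
        using rng_half_open by auto
      then show ?thesis
        unfolding L_def using P[of n] by (subst measure_distr) (auto simp: prob_space.prob_space)
    qed
    then show "\<exists>a b. a < b \<and> (\<forall>n. 1 - \<epsilon> < measure (L n) {a<..b})"
      using \<open>0 < \<epsilon>\<close> by (intro exI[of _ "-1"] exI[of _ "2"]) auto
  qed
  then obtain r M where r: "strict_mono r" and M: "real_distribution M"
    and conv: "weak_conv_m (L \<circ> r) M"
    using tight_imp_convergent_subsubsequence[of L id] by (auto simp: strict_mono_id)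
  interpret M: real_distribution M by (rule M)
  have conv_int: "(\<lambda>n. \<integral>t. g t \<partial>L (r n)) \<longlonglongrightarrow> (\<integral>t. g t \<partial>M)"
    if "continuous_on UNIV g" "\<And>t. \<bar>g t\<bar> \<le> b" for g :: "real \<Rightarrow> real" and b
    using weak_conv_imp_integral_bdd_continuous_conv[OF _ M conv, of g b] that L
    by (auto simp: continuous_on_eq_continuous_at comp_def)
  have AE_C: "AE t in M. t \<in> C"
  proof -
    \<comment> \<open>All the image measures give integral \<open>0\<close> to this bounded continuous function, hence so does \<open>M\<close>.\<close>
    let ?g = "\<lambda>t. min 1 (infdist t C)"
    have cg: "continuous_on UNIV ?g" by (intro continuous_intros)
    have gb: "\<bar>?g t\<bar> \<le> 1" for t using infdist_nonneg[of t C] by auto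
    have mg [measurable]: "?g \<in> borel_measurable borel"
      by (rule borel_measurable_continuous_onI[OF cg])
    have "(\<integral>t. ?g t \<partial>L n) = 0" for n
      using C by (subst intL[OF mg]) (simp add: infdist_zero)
    then have "(\<lambda>n. \<integral>t. ?g t \<partial>L (r n)) \<longlonglongrightarrow> 0" by simp
    then have "(\<integral>t. ?g t \<partial>M) = 0"
      by (rule LIMSEQ_unique[OF conv_int[OF cg gb]])
    moreover have "integrable M ?g"
      using gb by (intro M.integrable_const_bound[of _ 1]) auto
    ultimately have "AE t in M. ?g t = 0"
      using infdist_nonneg by (subst (asm) integral_nonneg_eq_0_iff_AE) auto
    then show ?thesis
      by eventually_elim (use in_closed_iff_infdist_zero[OF C(1,2)] in \<open>auto simp: min_def split: if_splits\<close>)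
  qed
  \<comment> \<open>The decoding is controlled only on \<open>C\<close>; the constant value elsewhere sits on an \<open>M\<close>-null set.\<close>
  define \<pi>' where "\<pi>' t = (if t \<in> C then \<pi> t else \<pi> 0)" for t
  have \<pi>' [measurable]: "\<pi>' \<in> borel_measurable borel"
    unfolding \<pi>'_def using C cont
    by (intro borel_measurable_continuous_on_if) (auto simp: C_def)
  define \<nu> where "\<nu> = distr M borel \<pi>'"
  show thesis
  proof (rule that[of r \<nu>])
    show "\<nu> \<in> borel_probs"
      unfolding \<nu>_def borel_probs_def using M.prob_space_distr[of \<pi>' borel] by auto
    fix f :: "'a \<Rightarrow> real" assume f: "continuous_on UNIV f"
    have [measurable]: "f \<in> borel_measurable borel" by (rule borel_measurable_continuous_onI[OF f])
    obtain b where b: "0 < b" "\<And>x. \<bar>f x\<bar> \<le> b" using continuous_compact_bounded[OF comp f] by blast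
    have "continuous_on C (f \<circ> \<pi>)"
      using cont f unfolding C_def by (intro continuous_on_compose) (auto intro: continuous_on_subset)
    then obtain g where g: "continuous_on UNIV g" "\<And>t. t \<in> C \<Longrightarrow> g t = (f \<circ> \<pi>) t" "\<And>t. norm (g t) \<le> b"
      using Tietze[of C "f \<circ> \<pi>" UNIV b] b C by auto
    have mg [measurable]: "g \<in> borel_measurable borel" by (rule borel_measurable_continuous_onI[OF g(1)])
    have "(\<integral>x. f x \<partial>\<nu>) = (\<integral>t. f (\<pi>' t) \<partial>M)"
      unfolding \<nu>_def by (subst integral_distr) auto
    also have "\<dots> = (\<integral>t. g t \<partial>M)"
    proof (rule integral_cong_AE)
      show "AE t in M. f (\<pi>' t) = g t"
        using AE_C by eventually_elim (simp add: \<pi>'_def g(2))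
    qed simp_all
    finally have "(\<integral>x. f x \<partial>\<nu>) = (\<integral>t. g t \<partial>M)" .
    moreover have "(\<integral>x. f x \<partial>\<mu> n) = (\<integral>t. g t \<partial>L n)" for n
      using g(2) C inv by (subst intL[OF mg]) simp
    ultimately show "(\<lambda>n. \<integral>x. f x \<partial>\<mu> (r n)) \<longlonglongrightarrow> (\<integral>x. f x \<partial>\<nu>)"
      using conv_int[OF g(1), of b] g(3) by simp
  qed (rule r)
qed

text \<open>
  The orbit segment has \<open>n + 1\<close> points, so that it is nonempty for every \<open>n\<close>.
\<close>
definition empirical_measure :: "('a::metric_space \<Rightarrow> 'a) \<Rightarrow> 'a \<Rightarrow> nat \<Rightarrow> 'a measure" where
  "empirical_measure T p n = distr (measure_pmf (pmf_of_set {..n})) borel (\<lambda>k. (T ^^ k) p)"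

lemma empirical_measure_borel_probs: "empirical_measure T p n \<in> borel_probs"
  unfolding empirical_measure_def borel_probs_def
  by (auto intro!: measure_pmf.prob_space_distr)

lemma integral_empirical_measure:
  fixes f :: "'a::metric_space \<Rightarrow> real"
  assumes "f \<in> borel_measurable borel"
  shows "(\<integral>x. f x \<partial>empirical_measure T p n) = birkhoff_avg T f p (Suc n)"
  unfolding empirical_measure_def birkhoff_avg_def using assms
  by (subst integral_distr) (auto simp: integral_pmf_of_set lessThan_Suc_atMost)

text \<open>
  Along a weakly convergent subsequence of the empirical measures, the time averages of \<open>f \<circ> T\<close> and of
  \<open>f\<close> differ by a telescoping sum divided by \<open>n\<close>, so the limit measure is invariant.
\<close>
lemma krylov_bogoliubov:
  fixes T :: "'a::metric_space \<Rightarrow> 'a"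
  assumes comp: "compact (UNIV :: 'a set)" and T: "continuous_on UNIV T"
  obtains r \<mu> where "strict_mono (r :: nat \<Rightarrow> nat)" "\<mu> \<in> invariant_probs T"
    "\<And>f :: 'a \<Rightarrow> real. continuous_on UNIV f \<Longrightarrow>
       (\<lambda>n. birkhoff_avg T f p (r n)) \<longlonglongrightarrow> (\<integral>x. f x \<partial>\<mu>)"
proof -
  obtain r \<mu> where r: "strict_mono (r :: nat \<Rightarrow> nat)" and \<mu>: "\<mu> \<in> borel_probs"
    and lim0: "\<And>f :: 'a \<Rightarrow> real. continuous_on UNIV f \<Longrightarrow>
       (\<lambda>n. \<integral>x. f x \<partial>empirical_measure T p (r n)) \<longlonglongrightarrow> (\<integral>x. f x \<partial>\<mu>)"
    using borel_probs_sequentially_compact[of "empirical_measure T p", OF comp empirical_measure_borel_probs]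
    by blast
  have lim: "(\<lambda>n. birkhoff_avg T f p (Suc (r n))) \<longlonglongrightarrow> (\<integral>x. f x \<partial>\<mu>)"
    if "continuous_on UNIV f" for f :: "'a \<Rightarrow> real"
    using lim0[OF that] borel_measurable_continuous_onI[OF that]
    by (simp add: integral_empirical_measure)
  have s [measurable_cong]: "sets \<mu> = sets borel" and P: "prob_space \<mu>"
    using \<mu> by (auto simp: borel_probs_def)
  have [measurable]: "T \<in> borel_measurable borel" by (rule borel_measurable_continuous_onI[OF T])
  have "distr \<mu> borel T = \<mu>"
  proof (rule borel_probs_eqI[OF _ \<mu>])
    show "distr \<mu> borel T \<in> borel_probs"
      unfolding borel_probs_def using prob_space.prob_space_distr[OF P, of T borel] by simp
    fix f :: "'a \<Rightarrow> real" assume f: "continuous_on UNIV f" and f01: "\<And>x. f x \<in> {0..1}"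
    have [measurable]: "f \<in> borel_measurable borel" by (rule borel_measurable_continuous_onI[OF f])
    have fT: "continuous_on UNIV (\<lambda>x. f (T x))"
      by (rule continuous_on_compose2[OF f T]) simp
    have "(\<lambda>n. birkhoff_avg T (\<lambda>x. f (T x)) p (Suc (r n)) - birkhoff_avg T f p (Suc (r n))) \<longlonglongrightarrow> 0"
    proof (rule Lim_null_comparison)
      have "birkhoff_avg T (\<lambda>x. f (T x)) p m - birkhoff_avg T f p m
          = (f ((T ^^ m) p) - f p) / real m" for m
        unfolding birkhoff_avg_def
        using sum_lessThan_telescope[of "\<lambda>k. f ((T ^^ k) p)" m]
        by (simp add: sum_subtractf flip: diff_divide_distrib)
      moreover have "\<bar>f ((T ^^ m) p) - f p\<bar> \<le> 1" for m
        using f01[of "(T ^^ m) p"] f01[of p] by auto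
      ultimately have "norm (birkhoff_avg T (\<lambda>x. f (T x)) p m - birkhoff_avg T f p m) \<le> 1 / real m" for m
        by (simp add: divide_right_mono)
      then show "\<forall>\<^sub>F n in sequentially. norm (birkhoff_avg T (\<lambda>x. f (T x)) p (Suc (r n))
          - birkhoff_avg T f p (Suc (r n))) \<le> 1 / real (Suc (r n))"
        by (intro always_eventually allI)
      have "strict_mono (Suc \<circ> r)" using r by (auto simp: strict_mono_def)
      from LIMSEQ_subseq_LIMSEQ[OF lim_const_over_n[of 1] this]
      show "(\<lambda>n. 1 / real (Suc (r n))) \<longlonglongrightarrow> 0" by (simp add: comp_def)
    qed
    moreover have "(\<lambda>n. birkhoff_avg T (\<lambda>x. f (T x)) p (Suc (r n)) - birkhoff_avg T f p (Suc (r n)))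
        \<longlonglongrightarrow> (\<integral>x. f (T x) \<partial>\<mu>) - (\<integral>x. f x \<partial>\<mu>)"
      by (intro tendsto_diff lim f fT)
    ultimately have "0 = (\<integral>x. f (T x) \<partial>\<mu>) - (\<integral>x. f x \<partial>\<mu>)"
      by (rule LIMSEQ_unique)
    then have "(\<integral>x. f (T x) \<partial>\<mu>) = (\<integral>x. f x \<partial>\<mu>)" by simp
    then show "(\<integral>x. f x \<partial>distr \<mu> borel T) = (\<integral>x. f x \<partial>\<mu>)"
      by (subst integral_distr) auto
  qed
  then show thesis
    using \<mu> lim r by (intro that[of "\<lambda>n. Suc (r n)" \<mu>]) (auto simp: invariant_probs_def strict_mono_def)
qed

section \<open>Kantorovich-Rubinstein and Hausdorff distances\<close>

text \<open>
  This bound, in terms of the diameter of the space, makes all the suprema and infima in the definitions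
  of the distances those of bounded sets.
\<close>
lemma nonexpansive_integral_diff_bounded:
  assumes comp: "compact (UNIV :: 'a::metric_space set)"
  obtains D where "\<And>(f :: 'a::metric_space \<Rightarrow> real) \<mu> \<nu>. 1-lipschitz_on UNIV f \<Longrightarrow>
    \<mu> \<in> borel_probs \<Longrightarrow> \<nu> \<in> borel_probs \<Longrightarrow> integral\<^sup>L \<mu> f - integral\<^sup>L \<nu> f \<le> D"
proof -
  define x0 :: 'a where "x0 = undefined"
  obtain D where D: "\<And>x :: 'a. dist x0 x \<le> D"
    using compact_imp_bounded[OF comp] unfolding bounded_any_center[of _ x0] by blast
  have near: "\<bar>integral\<^sup>L \<rho> f - f x0\<bar> \<le> D"
    if f: "1-lipschitz_on UNIV f" and \<rho>: "\<rho> \<in> borel_probs" for f :: "'a \<Rightarrow> real" and \<rho>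
  proof -
    interpret prob_space \<rho> using \<rho> by (simp add: borel_probs_def)
    have int: "integrable \<rho> f"
      using borel_probs_integrable[OF comp _ \<rho>] lipschitz_on_continuous_on[OF f] by blast
    have b: "f x0 - D \<le> f x" "f x \<le> f x0 + D" for x
      using lipschitz_onD[OF f, of x0 x] D[of x] by (auto simp: dist_real_def abs_le_iff)
    have "(\<integral>x. f x0 - D \<partial>\<rho>) \<le> integral\<^sup>L \<rho> f" "integral\<^sup>L \<rho> f \<le> (\<integral>x. f x0 + D \<partial>\<rho>)"
      by (rule integral_mono; use int b in simp)+
    then show ?thesis by (simp add: prob_space abs_le_iff)
  qed
  show thesis
  proof (rule that[of "2 * D"])
    fix f :: "'a \<Rightarrow> real" and \<mu> \<nu> :: "'a measure"
    assume "1-lipschitz_on UNIV f" "\<mu> \<in> borel_probs" "\<nu> \<in> borel_probs"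
    then show "integral\<^sup>L \<mu> f - integral\<^sup>L \<nu> f \<le> 2 * D"
      using near[of f \<mu>] near[of f \<nu>] by linarith
  qed
qed

lemma nonexpansive_integral_diff_le_kr_dist:
  fixes f :: "'a::metric_space \<Rightarrow> real"
  assumes comp: "compact (UNIV :: 'a set)" and f: "1-lipschitz_on UNIV f"
    and \<mu>: "\<mu> \<in> borel_probs" and \<nu>: "\<nu> \<in> borel_probs"
  shows "integral\<^sup>L \<mu> f - integral\<^sup>L \<nu> f \<le> kr_dist \<mu> \<nu>"
proof -
  obtain D where D: "\<And>(f :: 'a \<Rightarrow> real) \<mu> \<nu>. 1-lipschitz_on UNIV f \<Longrightarrow>
    \<mu> \<in> borel_probs \<Longrightarrow> \<nu> \<in> borel_probs \<Longrightarrow> integral\<^sup>L \<mu> f - integral\<^sup>L \<nu> f \<le> D"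
    using nonexpansive_integral_diff_bounded[OF comp] by blast
  show ?thesis
    unfolding kr_dist_def
    by (rule cSUP_upper) (use f D[OF _ \<mu> \<nu>] in \<open>auto intro!: bdd_aboveI2\<close>)
qed

lemma lipschitz_integral_diff_le_kr_dist:
  fixes f :: "'a::metric_space \<Rightarrow> real"
  assumes comp: "compact (UNIV :: 'a set)" and f: "L-lipschitz_on UNIV f"
    and \<mu>: "\<mu> \<in> borel_probs" and \<nu>: "\<nu> \<in> borel_probs"
  shows "\<bar>integral\<^sup>L \<mu> f - integral\<^sup>L \<nu> f\<bar> \<le> L * kr_dist \<mu> \<nu>"
proof (cases "L = 0")
  case True
  then have "f = (\<lambda>_. f undefined)"
    using lipschitz_onD[OF f] by (intro ext) simp
  then obtain c where "f = (\<lambda>_. c)" ..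
  then show ?thesis
    using \<mu> \<nu> True by (simp add: borel_probs_def prob_space.prob_space)
next
  case False
  then have L: "0 < L" using lipschitz_on_nonneg[OF f] by simp
  have lip: "1-lipschitz_on UNIV (\<lambda>x. c * f x)" if "\<bar>c\<bar> = 1 / L" for c
  proof (rule lipschitz_onI)
    show "dist (c * f x) (c * f y) \<le> 1 * dist x y" for x y
    proof -
      have "dist (c * f x) (c * f y) = \<bar>c\<bar> * dist (f x) (f y)"
        by (simp add: dist_real_def abs_mult flip: right_diff_distrib)
      also have "\<dots> \<le> \<bar>c\<bar> * (L * dist x y)"
        by (intro mult_left_mono lipschitz_onD[OF f]) auto
      finally show ?thesis using that L by simp
    qed
  qed simp
  have "c * (integral\<^sup>L \<mu> f - integral\<^sup>L \<nu> f) \<le> kr_dist \<mu> \<nu>" if "\<bar>c\<bar> = 1 / L" for c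
    using nonexpansive_integral_diff_le_kr_dist[OF comp lip[OF that] \<mu> \<nu>] by (simp add: right_diff_distrib)
  from this[of "1 / L"] this[of "- (1 / L)"] show ?thesis
    using L by (simp add: abs_le_iff field_simps)
qed

lemma kr_dist_nonneg:
  fixes \<mu> \<nu> :: "'a::metric_space measure"
  assumes "compact (UNIV :: 'a set)" "\<mu> \<in> borel_probs" "\<nu> \<in> borel_probs"
  shows "0 \<le> kr_dist \<mu> \<nu>"
  using nonexpansive_integral_diff_le_kr_dist[OF assms(1) _ assms(2,3), of "\<lambda>_. 0"]
  by (simp add: lipschitz_on_def)

text \<open>
  Both suprema in the Hausdorff distance are nonnegative, so the second alone, the deviation of \<open>Q\<close> from
  \<open>P\<close>, is less than \<open>e\<close>.
\<close>
lemma hausdorff_kr_less_imp_near: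
  fixes P Q :: "'a::metric_space measure set"
  assumes comp: "compact (UNIV :: 'a set)"
    and P: "P \<subseteq> borel_probs" "P \<noteq> {}" and Q: "Q \<subseteq> borel_probs"
    and less: "hausdorff_kr P Q < e" and q: "q \<in> Q"
  obtains p where "p \<in> P" "kr_dist q p < e"
proof -
  obtain D where D: "\<And>(f :: 'a \<Rightarrow> real) \<mu> \<nu>. 1-lipschitz_on UNIV f \<Longrightarrow>
    \<mu> \<in> borel_probs \<Longrightarrow> \<nu> \<in> borel_probs \<Longrightarrow> integral\<^sup>L \<mu> f - integral\<^sup>L \<nu> f \<le> D"
    using nonexpansive_integral_diff_bounded[OF comp] by blast
  have leD: "kr_dist \<mu> \<nu> \<le> D" if "\<mu> \<in> borel_probs" "\<nu> \<in> borel_probs" for \<mu> \<nu> :: "'a measure"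
    unfolding kr_dist_def
    by (rule cSUP_least) (use D that in \<open>auto intro!: exI[of _ "\<lambda>_. 0"] simp: lipschitz_on_def\<close>)
  have bdd: "bdd_below (kr_dist \<mu> ` R)" if "\<mu> \<in> borel_probs" "R \<subseteq> borel_probs"
    for \<mu> :: "'a measure" and R
    using kr_dist_nonneg[OF comp] that by (intro bdd_belowI2[of _ 0]) auto
  have sd: "0 \<le> kr_setdist \<mu> R" "kr_setdist \<mu> R \<le> D"
    if "\<mu> \<in> borel_probs" "R \<subseteq> borel_probs" "R \<noteq> {}" for \<mu> :: "'a measure" and R
  proof -
    show "0 \<le> kr_setdist \<mu> R"
      unfolding kr_setdist_def using that kr_dist_nonneg[OF comp] by (intro cINF_greatest) auto
    obtain \<nu> where "\<nu> \<in> R" using \<open>R \<noteq> {}\<close> by blast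
    then have "kr_setdist \<mu> R \<le> kr_dist \<mu> \<nu>"
      unfolding kr_setdist_def by (intro cINF_lower bdd that)
    also have "\<dots> \<le> D" using \<open>\<nu> \<in> R\<close> that by (intro leD) auto
    finally show "kr_setdist \<mu> R \<le> D" .
  qed
  have upper: "kr_setdist \<mu> R' \<le> (SUP \<mu>\<in>R. kr_setdist \<mu> R')"
    if "\<mu> \<in> R" "R \<subseteq> borel_probs" "R' \<subseteq> borel_probs" "R' \<noteq> {}"
    for \<mu> :: "'a measure" and R R'
    using that sd(2) by (intro cSUP_upper bdd_aboveI2[of _ _ D]) auto
  obtain p where p: "p \<in> P" using P by blast
  have "0 \<le> kr_setdist p Q" using p P Q q by (intro sd) auto
  also have "\<dots> \<le> (SUP p\<in>P. kr_setdist p Q)" using p P Q q by (intro upper) auto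
  finally have "kr_setdist q P < e"
    using less upper[of q Q P] q Q P unfolding hausdorff_kr_def by auto
  then show thesis
    using that cINF_less_iff[OF P(2) bdd[of q P], of e] q P(1) Q unfolding kr_setdist_def by auto
qed

text \<open>
  The infimal convolution \<open>\<psi> x = INF y. \<phi> y + L dist x y\<close> is \<open>L\<close>-Lipschitz and at most \<open>\<phi>\<close>. For \<open>L\<close> large it
  is at least \<open>\<phi> - \<eta>\<close>: near \<open>x\<close> by uniform continuity, and far from \<open>x\<close> because \<open>L dist x y\<close> exceeds the
  oscillation of \<open>\<phi>\<close>.
\<close>
lemma lipschitz_approximation:
  fixes \<phi> :: "'a::metric_space \<Rightarrow> real"
  assumes comp: "compact (UNIV :: 'a set)" and \<phi>: "continuous_on UNIV \<phi>" and \<eta>: "0 < \<eta>"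
  obtains L \<psi> where "L-lipschitz_on UNIV \<psi>" "\<And>x. \<bar>\<phi> x - \<psi> x\<bar> \<le> \<eta>"
proof -
  obtain B where B: "0 < B" "\<And>x. \<bar>\<phi> x\<bar> \<le> B"
    using continuous_compact_bounded[OF comp \<phi>] by blast
  obtain d where d: "0 < d" "\<And>x y. dist x y < d \<Longrightarrow> \<bar>\<phi> x - \<phi> y\<bar> < \<eta>"
    using compact_uniformly_continuous[OF \<phi> comp] \<eta>
    unfolding uniformly_continuous_on_def dist_real_def by (metis UNIV_I)
  define L where "L = 2 * B / d"
  have L: "0 \<le> L" using B d by (simp add: L_def)
  have low: "\<phi> x - \<eta> \<le> \<phi> y + L * dist x y" for x y
  proof (cases "dist x y < d")
    case True
    then show ?thesis using d(2)[OF True] mult_nonneg_nonneg[OF L zero_le_dist[of x y]] by linarith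
  next
    case False
    then have "2 * B \<le> L * dist x y"
      using B d mult_left_mono[of d "dist x y" L] L by (simp add: L_def)
    then show ?thesis using B(2)[of x] B(2)[of y] \<eta> by linarith
  qed
  define \<psi> where "\<psi> x = (INF y. \<phi> y + L * dist x y)" for x
  have bdd: "bdd_below (range (\<lambda>y. \<phi> y + L * dist x y))" for x
    using low by (intro bdd_belowI2) auto
  have le: "\<psi> x \<le> \<phi> y + L * dist x y" for x y
    unfolding \<psi>_def by (rule cINF_lower[OF bdd]) simp
  have ge: "c \<le> \<psi> x" if "\<And>y. c \<le> \<phi> y + L * dist x y" for c x
    unfolding \<psi>_def using that by (intro cINF_greatest) auto
  have half: "\<psi> x \<le> \<psi> y + L * dist x y" for x y
  proof -
    have "\<psi> x - L * dist x y \<le> \<psi> y"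
    proof (rule ge)
      fix z
      have "L * dist x z \<le> L * (dist x y + dist y z)"
        by (intro mult_left_mono dist_triangle L)
      then show "\<psi> x - L * dist x y \<le> \<phi> z + L * dist y z"
        using le[of x z] by (simp add: algebra_simps)
    qed
    then show ?thesis by simp
  qed
  show thesis
  proof (rule that[of L \<psi>])
    show "L-lipschitz_on UNIV \<psi>"
    proof (rule lipschitz_onI[OF _ L])
      show "dist (\<psi> x) (\<psi> y) \<le> L * dist x y" for x y
        using half[of x y] half[of y x] by (auto simp: dist_real_def abs_le_iff dist_commute)
    qed
    show "\<bar>\<phi> x - \<psi> x\<bar> \<le> \<eta>" for x
      using le[of x x] ge[OF low, of x] \<eta> by (simp add: abs_le_iff)
  qed
qed

section \<open>Points typical for an invariant measure near an orbit\<close>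

definition tent :: "real \<Rightarrow> 'a::metric_space set \<Rightarrow> 'a \<Rightarrow> real" where
  "tent \<sigma> A x = max 0 (1 - infdist x A / \<sigma>)"

lemma tent_range:
  assumes "0 < \<sigma>" shows "tent \<sigma> A x \<in> {0..1}"
  using assms infdist_nonneg[of x A] by (simp add: tent_def)

lemma tent_lipschitz:
  assumes "0 < \<sigma>" shows "(1 / \<sigma>)-lipschitz_on UNIV (tent \<sigma> A)"
proof (rule lipschitz_onI)
  show "dist (tent \<sigma> A x) (tent \<sigma> A y) \<le> 1 / \<sigma> * dist x y" for x y
  proof -
    have "dist (tent \<sigma> A x) (tent \<sigma> A y) \<le> \<bar>infdist x A / \<sigma> - infdist y A / \<sigma>\<bar>"
      by (auto simp: tent_def dist_real_def)
    also have "\<dots> = \<bar>infdist x A - infdist y A\<bar> / \<sigma>"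
      using assms by (simp flip: diff_divide_distrib)
    also have "\<dots> \<le> dist x y / \<sigma>"
      using assms by (intro divide_right_mono infdist_triangle_abs) auto
    finally show ?thesis by simp
  qed
qed (use assms in simp)

lemma tent_pos_imp_open_nbhd:
  assumes "0 < \<sigma>" "A \<noteq> {}" "0 < tent \<sigma> A x"
  shows "x \<in> open_nbhd \<sigma> A"
proof -
  have "infdist x A < \<sigma>" using assms by (auto simp: tent_def max_def field_simps split: if_splits)
  then obtain a where "a \<in> A" "dist x a < \<sigma>"
    using infdist_notempty[OF assms(2), of x] cINF_less_iff[of A "dist x" \<sigma>] assms(2)
    by (auto intro: bdd_belowI2[of _ 0])
  then show ?thesis by (auto simp: open_nbhd_def dist_commute)
qed

lemma birkhoff_avg_tent_le_visit_freq:
  assumes "0 < \<sigma>" "A \<noteq> {}"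
  shows "birkhoff_avg S (tent \<sigma> A) q n \<le> visit_freq S (open_nbhd \<sigma> A) q n"
proof -
  have "(\<Sum>k<n. tent \<sigma> A ((S ^^ k) q)) \<le> (\<Sum>k<n. indicator (open_nbhd \<sigma> A) ((S ^^ k) q))"
  proof (rule sum_mono)
    show "tent \<sigma> A ((S ^^ k) q) \<le> indicator (open_nbhd \<sigma> A) ((S ^^ k) q)" for k
    proof (cases "(S ^^ k) q \<in> open_nbhd \<sigma> A")
      case True
      then show ?thesis using tent_range[OF assms(1), of A "(S ^^ k) q"] by simp
    next
      case False
      then have "\<not> 0 < tent \<sigma> A ((S ^^ k) q)" using tent_pos_imp_open_nbhd[OF assms] by blast
      then show ?thesis using False by simp
    qed
  qed
  also have "\<dots> = real (card {k. k < n \<and> (S ^^ k) q \<in> open_nbhd \<sigma> A})"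
    by (simp add: indicator_def sum.If_cases Int_def)
  finally show ?thesis
    by (simp add: birkhoff_avg_def visit_freq_def divide_right_mono)
qed

lemma birkhoff_avg_penalised:
  assumes "0 < n"
  shows "birkhoff_avg S (\<lambda>x. \<phi> x - C * (1 - f x)) q n
    = birkhoff_avg S \<phi> q n - C * (1 - birkhoff_avg S f q n)"
  using assms
  by (simp add: birkhoff_avg_def sum_subtractf sum.distrib right_diff_distrib diff_divide_distrib
      flip: sum_distrib_left)

text \<open>
  The point is found from the penalised observable \<open>\<phi> - C (1 - f)\<close>, with \<open>f\<close> the tent over \<open>A\<close>. The tolerance
  \<open>\<kappa>\<close> depends only on \<open>\<phi>\<close>, \<open>\<epsilon>\<close> and \<open>\<sigma>\<close>, which is what makes the final \<open>\<delta>\<close> uniform in \<open>p\<close> and \<open>S\<close>.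
\<close>
lemma exists_typical_point_of_near_measure:
  fixes \<phi> :: "'a::metric_space \<Rightarrow> real"
  assumes comp: "compact (UNIV :: 'a set)" and \<phi>: "continuous_on UNIV \<phi>"
    and \<epsilon>: "0 < \<epsilon>" and \<sigma>: "0 < \<sigma>"
  obtains \<kappa> where "0 < \<kappa>"
    "\<And>S \<mu> \<nu> A. continuous_on UNIV S \<Longrightarrow> A \<noteq> {} \<Longrightarrow> \<mu> \<in> borel_probs \<Longrightarrow> integral\<^sup>L \<mu> (tent \<sigma> A) = 1 \<Longrightarrow>
       \<nu> \<in> invariant_probs S \<Longrightarrow> kr_dist \<mu> \<nu> < \<kappa> \<Longrightarrow>
       \<exists>q L. ereal (1 - \<epsilon>) \<le> liminf (\<lambda>n. ereal (visit_freq S (open_nbhd \<sigma> A) q n)) \<and>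
         birkhoff_avg S \<phi> q \<longlonglongrightarrow> L \<and> integral\<^sup>L \<mu> \<phi> - \<epsilon> \<le> L"
proof -
  obtain B where B: "0 < B" "\<And>x. \<bar>\<phi> x\<bar> \<le> B"
    using continuous_compact_bounded[OF comp \<phi>] by blast
  \<comment> \<open>The time average of \<open>\<phi>\<close> exceeds \<open>\<integral>\<phi> d\<mu> - 1\<close> by at most \<open>2 B + 1\<close>; if the tent average fell
      short of \<open>1\<close> by more than \<open>\<epsilon>\<close>, the penalty would exceed this.\<close>
  define C where "C = (2 * B + 1) / \<epsilon>"
  define \<gamma> where "\<gamma> = min \<epsilon> 1"
  have C: "0 < C" and \<gamma>: "0 < \<gamma>" "\<gamma> \<le> \<epsilon>" "\<gamma> \<le> 1"
    using B \<epsilon> by (auto simp: C_def \<gamma>_def)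
  obtain l \<psi> where \<psi>: "l-lipschitz_on UNIV \<psi>" "\<And>x. \<bar>\<phi> x - \<psi> x\<bar> \<le> \<gamma> / 4"
    using lipschitz_approximation[OF comp \<phi>, of "\<gamma> / 4"] \<gamma> by auto
  have \<psi>_close: "\<phi> x \<le> \<psi> x + \<gamma> / 4" "\<psi> x \<le> \<phi> x + \<gamma> / 4" for x
    using \<psi>(2)[of x] by linarith+
  have l: "0 \<le> l" using lipschitz_on_nonneg[OF \<psi>(1)] .
  \<comment> \<open>Half of \<open>\<gamma>\<close> is spent on replacing \<open>\<phi>\<close> by \<open>\<psi>\<close> under both measures, half on passing from \<open>\<mu>\<close> to \<open>\<nu>\<close>.\<close>
  define \<kappa> where "\<kappa> = \<gamma> / 2 / (l + C / \<sigma> + 1)"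
  have den: "0 < l + C / \<sigma> + 1" using l C \<sigma> by (simp add: add_nonneg_pos)
  show thesis
  proof (rule that[of \<kappa>])
    show "0 < \<kappa>" using \<gamma> den by (simp add: \<kappa>_def)
    fix S :: "'a \<Rightarrow> 'a" and \<mu> \<nu> A
    assume S: "continuous_on UNIV S" and A: "A \<noteq> {}" and \<mu>: "\<mu> \<in> borel_probs"
      and tent1: "integral\<^sup>L \<mu> (tent \<sigma> A) = 1" and inv: "\<nu> \<in> invariant_probs S"
      and near: "kr_dist \<mu> \<nu> < \<kappa>"
    have \<nu>: "\<nu> \<in> borel_probs" and dS: "distr \<nu> borel S = \<nu>"
      using inv by (auto simp: invariant_probs_def)
    have s [measurable_cong]: "sets \<nu> = sets borel" using \<nu> by (simp add: borel_probs_def)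
    interpret M: prob_space \<mu> using \<mu> by (simp add: borel_probs_def)
    interpret N: prob_space \<nu> using \<nu> by (simp add: borel_probs_def)
    interpret N: measure_preserving_system \<nu> S
    proof
      have "S \<in> measurable borel borel" by (rule borel_measurable_continuous_onI[OF S])
      then show "S \<in> measurable \<nu> \<nu>" by (simp add: measurable_cong_sets[OF s s])
      show "distr \<nu> \<nu> S = \<nu>" using distr_cong[OF refl s, of \<nu> S S] dS by simp
    qed
    let ?f = "tent \<sigma> A"
    let ?g = "\<lambda>x. \<phi> x - C * (1 - ?f x)"
    have f_cont: "continuous_on UNIV ?f"
      using lipschitz_on_continuous_on[OF tent_lipschitz[OF \<sigma>]] .
    have \<psi>_cont: "continuous_on UNIV \<psi>"
      using lipschitz_on_continuous_on[OF \<psi>(1)] .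
    note int = borel_probs_integrable[OF comp _ \<mu>] borel_probs_integrable[OF comp _ \<nu>]
    have [measurable]: "\<phi> \<in> borel_measurable borel" "?f \<in> borel_measurable borel"
      using \<phi> f_cont by (auto intro: borel_measurable_continuous_onI)
    have f01: "0 \<le> ?f x" "?f x \<le> 1" for x using tent_range[OF \<sigma>, of A x] by auto

    have kr0: "0 \<le> kr_dist \<mu> \<nu>" by (rule kr_dist_nonneg[OF comp \<mu> \<nu>])
    have "1 - integral\<^sup>L \<nu> ?f \<le> kr_dist \<mu> \<nu> / \<sigma>"
      using lipschitz_integral_diff_le_kr_dist[OF comp tent_lipschitz[OF \<sigma>] \<mu> \<nu>, of A] tent1
      by (simp add: abs_le_iff)
    then have "C * (1 - integral\<^sup>L \<nu> ?f) \<le> C / \<sigma> * kr_dist \<mu> \<nu>"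
      using mult_left_mono[of _ _ C] C by fastforce
    moreover have "integral\<^sup>L \<mu> \<psi> - integral\<^sup>L \<nu> \<psi> \<le> l * kr_dist \<mu> \<nu>"
      using lipschitz_integral_diff_le_kr_dist[OF comp \<psi>(1) \<mu> \<nu>] by (simp add: abs_le_iff)
    moreover have "integral\<^sup>L \<mu> \<phi> \<le> integral\<^sup>L \<mu> \<psi> + \<gamma> / 4"
    proof -
      have "integral\<^sup>L \<mu> \<phi> \<le> (\<integral>x. \<psi> x + \<gamma> / 4 \<partial>\<mu>)"
        by (rule integral_mono) (use \<psi>_close int(1)[OF \<phi>] int(1)[OF \<psi>_cont] in auto)
      then show ?thesis using int(1)[OF \<psi>_cont] by (simp add: M.prob_space)
    qed
    moreover have "integral\<^sup>L \<nu> \<psi> \<le> integral\<^sup>L \<nu> \<phi> + \<gamma> / 4"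
    proof -
      have "integral\<^sup>L \<nu> \<psi> \<le> (\<integral>x. \<phi> x + \<gamma> / 4 \<partial>\<nu>)"
        by (rule integral_mono) (use \<psi>_close int(2)[OF \<phi>] int(2)[OF \<psi>_cont] in auto)
      then show ?thesis using int(2)[OF \<phi>] by (simp add: N.prob_space)
    qed
    moreover have "(l + C / \<sigma>) * kr_dist \<mu> \<nu> \<le> \<gamma> / 2"
    proof -
      have "(l + C / \<sigma>) * kr_dist \<mu> \<nu> \<le> (l + C / \<sigma> + 1) * kr_dist \<mu> \<nu>"
        using kr0 by (intro mult_right_mono) auto
      also have "\<dots> \<le> (l + C / \<sigma> + 1) * \<kappa>"
        using near den by (intro mult_left_mono) auto
      also have "\<dots> = \<gamma> / 2"
        unfolding \<kappa>_def using den
        by (subst times_divide_eq_right, intro nonzero_mult_div_cancel_left) linarith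
      finally show ?thesis .
    qed
    moreover have "integral\<^sup>L \<nu> ?g = integral\<^sup>L \<nu> \<phi> - C * (1 - integral\<^sup>L \<nu> ?f)"
      using int(2)[OF \<phi>] int(2)[OF f_cont] by (simp add: N.prob_space)
    ultimately have g_int: "integral\<^sup>L \<mu> \<phi> - \<gamma> \<le> integral\<^sup>L \<nu> ?g"
      by (simp add: distrib_right)

    have f_AE: "AE x in \<nu>. \<exists>a. birkhoff_avg S ?f x \<longlonglongrightarrow> a"
    proof -
      obtain u where "AE x in \<nu>. birkhoff_avg S ?f x \<longlonglongrightarrow> u x"
        using N.pointwise_ergodic_theorem_bounded[of ?f 1] f01 by (metis \<open>?f \<in> borel_measurable borel\<close> abs_of_nonneg measurable_cong_sets s)
      then show ?thesis by eventually_elim blast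
    qed
    have g_bd: "\<bar>?g x\<bar> \<le> B + C" for x
    proof -
      have "0 \<le> C * (1 - ?f x)" "C * (1 - ?f x) \<le> C * 1"
        using C f01[of x] by (intro mult_nonneg_nonneg mult_left_mono; simp)+
      then show ?thesis using B(2)[of x] by (simp add: abs_le_iff)
    qed
    have g_meas: "?g \<in> borel_measurable \<nu>" by measurable
    obtain q b where q: "\<exists>a. birkhoff_avg S ?f q \<longlonglongrightarrow> a" "birkhoff_avg S ?g q \<longlonglongrightarrow> b"
      "integral\<^sup>L \<nu> ?g \<le> b"
      using N.exists_point_birkhoff_limit_ge[OF g_meas g_bd f_AE] by blast
    then obtain a where a: "birkhoff_avg S ?f q \<longlonglongrightarrow> a" by blast
    define L where "L = b + C * (1 - a)"
    have a1: "a \<le> 1"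
      by (rule tendsto_upperbound[OF a])
        (auto intro: eventually_mono[OF eventually_gt_at_top[of 0]] birkhoff_avg_le f01)
    have L: "birkhoff_avg S \<phi> q \<longlonglongrightarrow> L"
    proof (rule Lim_transform_eventually)
      show "(\<lambda>n. birkhoff_avg S ?g q n + C * (1 - birkhoff_avg S ?f q n)) \<longlonglongrightarrow> L"
        unfolding L_def by (intro tendsto_intros a q)
      show "\<forall>\<^sub>F n in sequentially. birkhoff_avg S ?g q n + C * (1 - birkhoff_avg S ?f q n) = birkhoff_avg S \<phi> q n"
        using eventually_gt_at_top[of 0] by eventually_elim (simp add: birkhoff_avg_penalised)
    qed
    have L_le: "L \<le> B"
    proof (rule tendsto_upperbound[OF L])
      have "\<phi> x \<le> B" for x using B(2)[of x] by (simp add: abs_le_iff)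
      then have "birkhoff_avg S \<phi> q n \<le> B" if "0 < n" for n
        using that by (intro birkhoff_avg_le)
      then show "\<forall>\<^sub>F n in sequentially. birkhoff_avg S \<phi> q n \<le> B"
        using eventually_gt_at_top[of 0] by (rule eventually_mono[rotated])
    qed simp
    have "- B \<le> integral\<^sup>L \<mu> \<phi>"
    proof -
      have "(\<integral>x. - B \<partial>\<mu>) \<le> integral\<^sup>L \<mu> \<phi>"
      proof (rule integral_mono)
        show "- B \<le> \<phi> x" for x using B(2)[of x] by (simp add: abs_le_iff)
      qed (use int(1)[OF \<phi>] in auto)
      then show ?thesis by (simp add: M.prob_space)
    qed
    then have "C * (1 - a) \<le> 2 * B + 1"
      using L_le q(3) g_int \<gamma> by (simp add: L_def)
    then have "(2 * B + 1) * (1 - a) \<le> (2 * B + 1) * \<epsilon>"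
      using \<epsilon> by (simp add: C_def field_simps)
    then have "1 - a \<le> \<epsilon>"
      using B by (simp add: mult_le_cancel_left)
    have "ereal (1 - \<epsilon>) \<le> ereal a" using \<open>1 - a \<le> \<epsilon>\<close> by simp
    also have "\<dots> = liminf (\<lambda>n. ereal (birkhoff_avg S ?f q n))"
      using a by (intro lim_imp_Liminf[symmetric]) auto
    also have "\<dots> \<le> liminf (\<lambda>n. ereal (visit_freq S (open_nbhd \<sigma> A) q n))"
      by (intro Liminf_mono always_eventually) (simp add: birkhoff_avg_tent_le_visit_freq[OF \<sigma> A])
    finally have "ereal (1 - \<epsilon>) \<le> \<dots>" .
    moreover have "integral\<^sup>L \<mu> \<phi> - \<epsilon> \<le> L"
    proof -
      have "0 \<le> C * (1 - a)" using C a1 by simp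
      then show ?thesis using q(3) g_int \<gamma> by (simp add: L_def)
    qed
    ultimately show "\<exists>q L. ereal (1 - \<epsilon>) \<le> liminf (\<lambda>n. ereal (visit_freq S (open_nbhd \<sigma> A) q n)) \<and>
         birkhoff_avg S \<phi> q \<longlonglongrightarrow> L \<and> integral\<^sup>L \<mu> \<phi> - \<epsilon> \<le> L"
      using L by blast
  qed
qed

lemma invariant_probs_nonempty:
  fixes T :: "'a::metric_space \<Rightarrow> 'a"
  assumes "compact (UNIV :: 'a set)" "continuous_on UNIV T"
  shows "invariant_probs T \<noteq> {}"
  using krylov_bogoliubov[OF assms] by blast

text \<open>
  The tent over the orbit closure equals \<open>1\<close> along the orbit of \<open>p\<close>, hence so do its time averages and its
  integral. The integral of \<open>\<phi>\<close> is a subsequential limit of time averages at \<open>p\<close>.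
\<close>
lemma orbit_limit_measure:
  fixes T :: "'a::metric_space \<Rightarrow> 'a"
  assumes comp: "compact (UNIV :: 'a set)" and T: "continuous_on UNIV T"
    and \<phi>: "continuous_on UNIV \<phi>" and \<sigma>: "0 < \<sigma>"
  obtains \<mu> where "\<mu> \<in> invariant_probs T"
    "integral\<^sup>L \<mu> (tent \<sigma> (closure (pos_semiorbit T p))) = 1"
    "lower_avg T \<phi> p \<le> ereal (integral\<^sup>L \<mu> \<phi>)" "ereal (integral\<^sup>L \<mu> \<phi>) \<le> upper_avg T \<phi> p"
proof -
  obtain r \<mu> where r: "strict_mono (r :: nat \<Rightarrow> nat)" and \<mu>: "\<mu> \<in> invariant_probs T"
    and lim: "\<And>f :: 'a \<Rightarrow> real. continuous_on UNIV f \<Longrightarrow>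
       (\<lambda>n. birkhoff_avg T f p (r n)) \<longlonglongrightarrow> (\<integral>x. f x \<partial>\<mu>)"
    using krylov_bogoliubov[OF comp T] by metis
  have lim\<phi>: "(\<lambda>n. ereal (birkhoff_avg T \<phi> p (r n))) \<longlonglongrightarrow> ereal (integral\<^sup>L \<mu> \<phi>)"
    using lim[OF \<phi>] by simp
  show thesis
  proof (rule that[OF \<mu>])
    let ?f = "tent \<sigma> (closure (pos_semiorbit T p))"
    have "?f ((T ^^ k) p) = 1" for k
    proof -
      have "(T ^^ k) p \<in> closure (pos_semiorbit T p)"
        by (rule closure_subset[THEN subsetD]) (auto simp: pos_semiorbit_def)
      then show ?thesis by (simp add: tent_def)
    qed
    then have one: "birkhoff_avg T ?f p n = 1" if "0 < n" for n
      using that by (simp add: birkhoff_avg_def)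
    have "continuous_on UNIV ?f"
      using lipschitz_on_continuous_on[OF tent_lipschitz[OF \<sigma>]] .
    from lim[OF this] have "(\<lambda>n. birkhoff_avg T ?f p (r n)) \<longlonglongrightarrow> integral\<^sup>L \<mu> ?f" .
    moreover have "(\<lambda>n. birkhoff_avg T ?f p (r n)) \<longlonglongrightarrow> 1"
    proof (rule tendsto_eventually)
      show "\<forall>\<^sub>F n in sequentially. birkhoff_avg T ?f p (r n) = 1"
        using eventually_gt_at_top[of 0]
        by eventually_elim (meson less_le_trans one r seq_suble)
    qed
    ultimately show "integral\<^sup>L \<mu> ?f = 1" by (rule LIMSEQ_unique)
    have "lower_avg T \<phi> p \<le> liminf (\<lambda>n. ereal (birkhoff_avg T \<phi> p (r n)))"
      unfolding lower_avg_def using liminf_subseq_mono[OF r] by (simp add: comp_def)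
    then show "lower_avg T \<phi> p \<le> ereal (integral\<^sup>L \<mu> \<phi>)"
      using lim_imp_Liminf[OF _ lim\<phi>] by simp
    have "limsup (\<lambda>n. ereal (birkhoff_avg T \<phi> p (r n))) \<le> upper_avg T \<phi> p"
      unfolding upper_avg_def
      using limsup_subseq_mono[OF r, of "\<lambda>n. ereal (birkhoff_avg T \<phi> p n)"] by (simp add: comp_def)
    then show "ereal (integral\<^sup>L \<mu> \<phi>) \<le> upper_avg T \<phi> p"
      using lim_imp_Limsup[OF _ lim\<phi>] by simp
  qed
qed

theorem theorem3p3:
  fixes T :: "'a::metric_space \<Rightarrow>\<^sub>C 'a"
    and \<phi> :: "'a \<Rightarrow> real"
    and \<epsilon> \<sigma> :: real
  assumes "compact (UNIV :: 'a set)"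
    and "T \<in> continuity_maps"
    and "continuous_on UNIV \<phi>"
    and "\<epsilon> > 0"
    and "\<sigma> > 0"
  shows "\<exists>\<delta>>0. \<forall>p. \<forall>S :: 'a \<Rightarrow>\<^sub>C 'a. dist S T < \<delta> \<longrightarrow>
    (\<exists>q\<^sub>m q\<^sub>p.
      (\<forall>q \<in> {q\<^sub>m, q\<^sub>p}.
        liminf (\<lambda>n. ereal (visit_freq (apply_bcontfun S)
            (open_nbhd \<sigma> (closure (pos_semiorbit (apply_bcontfun T) p))) q n)) \<ge> ereal (1 - \<epsilon>)) \<and>
      (\<exists>L. birkhoff_avg (apply_bcontfun S) \<phi> q\<^sub>p \<longlonglongrightarrow> L \<and>
        ereal L \<ge> lower_avg (apply_bcontfun T) \<phi> p - ereal \<epsilon>) \<and>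
      (\<exists>L. birkhoff_avg (apply_bcontfun S) \<phi> q\<^sub>m \<longlonglongrightarrow> L \<and>
        ereal L \<le> upper_avg (apply_bcontfun T) \<phi> p + ereal \<epsilon>))"
proof -
  note comp = assms(1) and \<phi> = assms(3)
  have neg\<phi>: "continuous_on UNIV (\<lambda>x. - \<phi> x)" using \<phi> by (intro continuous_intros)
  obtain \<kappa>\<^sub>p where \<kappa>p: "0 < \<kappa>\<^sub>p"
    "\<And>S \<mu> \<nu> A. continuous_on UNIV S \<Longrightarrow> A \<noteq> {} \<Longrightarrow> \<mu> \<in> borel_probs \<Longrightarrow> integral\<^sup>L \<mu> (tent \<sigma> A) = 1 \<Longrightarrow>
       \<nu> \<in> invariant_probs S \<Longrightarrow> kr_dist \<mu> \<nu> < \<kappa>\<^sub>p \<Longrightarrow>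
       \<exists>q L. ereal (1 - \<epsilon>) \<le> liminf (\<lambda>n. ereal (visit_freq S (open_nbhd \<sigma> A) q n)) \<and>
         birkhoff_avg S \<phi> q \<longlonglongrightarrow> L \<and> integral\<^sup>L \<mu> \<phi> - \<epsilon> \<le> L"
    using exists_typical_point_of_near_measure[OF comp \<phi> assms(4,5)] by blast
  obtain \<kappa>\<^sub>m where \<kappa>m: "0 < \<kappa>\<^sub>m"
    "\<And>S \<mu> \<nu> A. continuous_on UNIV S \<Longrightarrow> A \<noteq> {} \<Longrightarrow> \<mu> \<in> borel_probs \<Longrightarrow> integral\<^sup>L \<mu> (tent \<sigma> A) = 1 \<Longrightarrow>
       \<nu> \<in> invariant_probs S \<Longrightarrow> kr_dist \<mu> \<nu> < \<kappa>\<^sub>m \<Longrightarrow>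
       \<exists>q L. ereal (1 - \<epsilon>) \<le> liminf (\<lambda>n. ereal (visit_freq S (open_nbhd \<sigma> A) q n)) \<and>
         birkhoff_avg S (\<lambda>x. - \<phi> x) q \<longlonglongrightarrow> L \<and> (\<integral>x. - \<phi> x \<partial>\<mu>) - \<epsilon> \<le> L"
    using exists_typical_point_of_near_measure[OF comp neg\<phi> assms(4,5)] by blast
  obtain \<delta> where \<delta>: "0 < \<delta>" "\<And>S. dist S T < \<delta> \<Longrightarrow>
      hausdorff_kr (invariant_probs (apply_bcontfun S)) (invariant_probs (apply_bcontfun T)) < min \<kappa>\<^sub>p \<kappa>\<^sub>m"
    using assms(2) \<kappa>p(1) \<kappa>m(1) unfolding continuity_maps_def mem_Collect_eq by (metis min_less_iff_conj)
  show ?thesis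
  proof (intro exI[of _ \<delta>] conjI \<delta>(1) allI impI)
    fix p :: 'a and S :: "'a \<Rightarrow>\<^sub>C 'a"
    assume near: "dist S T < \<delta>"
    let ?S = "apply_bcontfun S" and ?T = "apply_bcontfun T"
    let ?A = "closure (pos_semiorbit ?T p)"
    have S: "continuous_on UNIV ?S" and T: "continuous_on UNIV ?T" by simp_all
    have A: "?A \<noteq> {}" by (auto simp: pos_semiorbit_def)
    obtain \<mu> where \<mu>: "\<mu> \<in> invariant_probs ?T" "integral\<^sup>L \<mu> (tent \<sigma> ?A) = 1"
      "lower_avg ?T \<phi> p \<le> ereal (integral\<^sup>L \<mu> \<phi>)" "ereal (integral\<^sup>L \<mu> \<phi>) \<le> upper_avg ?T \<phi> p"
      using orbit_limit_measure[OF comp T \<phi> assms(5)] by blast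
    have sub: "invariant_probs R \<subseteq> borel_probs" for R :: "'a \<Rightarrow> 'a"
      by (auto simp: invariant_probs_def)
    obtain \<nu> where \<nu>: "\<nu> \<in> invariant_probs ?S" "kr_dist \<mu> \<nu> < min \<kappa>\<^sub>p \<kappa>\<^sub>m"
      using hausdorff_kr_less_imp_near[OF comp sub invariant_probs_nonempty[OF comp S] sub \<delta>(2)[OF near] \<mu>(1)]
      by blast
    have \<mu>_borel: "\<mu> \<in> borel_probs" using \<mu>(1) sub by blast
    obtain q\<^sub>p L\<^sub>p where qp: "ereal (1 - \<epsilon>) \<le> liminf (\<lambda>n. ereal (visit_freq ?S (open_nbhd \<sigma> ?A) q\<^sub>p n))"
      "birkhoff_avg ?S \<phi> q\<^sub>p \<longlonglongrightarrow> L\<^sub>p" "integral\<^sup>L \<mu> \<phi> - \<epsilon> \<le> L\<^sub>p"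
      using \<kappa>p(2)[OF S A \<mu>_borel \<mu>(2) \<nu>(1)] \<nu>(2) by auto
    obtain q\<^sub>m L\<^sub>m where qm: "ereal (1 - \<epsilon>) \<le> liminf (\<lambda>n. ereal (visit_freq ?S (open_nbhd \<sigma> ?A) q\<^sub>m n))"
      "birkhoff_avg ?S (\<lambda>x. - \<phi> x) q\<^sub>m \<longlonglongrightarrow> L\<^sub>m" "(\<integral>x. - \<phi> x \<partial>\<mu>) - \<epsilon> \<le> L\<^sub>m"
      using \<kappa>m(2)[OF S A \<mu>_borel \<mu>(2) \<nu>(1)] \<nu>(2) by auto
    have "birkhoff_avg ?S (\<lambda>x. - \<phi> x) q\<^sub>m = (\<lambda>n. - birkhoff_avg ?S \<phi> q\<^sub>m n)"
      by (rule ext) (simp add: birkhoff_avg_def sum_negf)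
    then have avg_m: "birkhoff_avg ?S \<phi> q\<^sub>m \<longlonglongrightarrow> - L\<^sub>m"
      using tendsto_minus[OF qm(2)] by simp
    have "lower_avg ?T \<phi> p - ereal \<epsilon> \<le> ereal (integral\<^sup>L \<mu> \<phi>) - ereal \<epsilon>"
      by (intro ereal_minus_mono \<mu>(3)) simp
    also have "\<dots> \<le> ereal L\<^sub>p" using qp(3) by simp
    finally have up: "lower_avg ?T \<phi> p - ereal \<epsilon> \<le> ereal L\<^sub>p" .
    have "ereal (- L\<^sub>m) \<le> ereal (integral\<^sup>L \<mu> \<phi>) + ereal \<epsilon>" using qm(3) by simp
    also have "\<dots> \<le> upper_avg ?T \<phi> p + ereal \<epsilon>"
      by (intro add_mono \<mu>(4)) simp
    finally have down: "ereal (- L\<^sub>m) \<le> upper_avg ?T \<phi> p + ereal \<epsilon>" .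
    show "\<exists>q\<^sub>m q\<^sub>p.
      (\<forall>q \<in> {q\<^sub>m, q\<^sub>p}. liminf (\<lambda>n. ereal (visit_freq ?S (open_nbhd \<sigma> ?A) q n)) \<ge> ereal (1 - \<epsilon>)) \<and>
      (\<exists>L. birkhoff_avg ?S \<phi> q\<^sub>p \<longlonglongrightarrow> L \<and> ereal L \<ge> lower_avg ?T \<phi> p - ereal \<epsilon>) \<and>
      (\<exists>L. birkhoff_avg ?S \<phi> q\<^sub>m \<longlonglongrightarrow> L \<and> ereal L \<le> upper_avg ?T \<phi> p + ereal \<epsilon>)"
      using qp(1,2) qm(1) avg_m up down by blast
  qed
qed

end
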